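(* Let $n\ge1$, let $\Omega\subset\mathbb{R}^n$ be a bounded convex open set, and let $K:\Omega\to\mathbb{R}$ be a Borel function with $\overline{\Omega}=\overline{\{x\in\Omega\mid K(x)>0\}}$, with $0<\lambda_1\le K(x)\le\lambda_2$ for all $x\in\Omega$ for some constants $\lambda_1,\lambda_2$, and with $$\int_\Omega K(x)\,dx=\omega_n,$$ where $\omega_n$ is the Lebesgue measure of the unit ball of $\mathbb{R}^n$. Let $\Omega^*$ be a geodesically convex subset of $\mathbb{S}^n_-$ with $\int_\Omega K\,dx=\int_{\Omega^*}(-y_{n+1})\,d\mathrm{Vol}_{\mathbb{S}^n}(\bar y)$, and let $u$ be a Brenier solution of the optimal transport problem with cost $c(x,\bar y)=\langle x,\tfrac{y}{y_{n+1}}\rangle$ between $K\,dx$ on $\Omega$ and $-y_{n+1}\mathbf{1}_{\Omega^*}\,d\mathrm{Vol}_{\mathbb{S}^n}$. Suppose furthermore that there exist $C_0,r_0>0$ and $\delta\in(0,1)$ such that $$K(x)\le\frac{C_0}{d(x,\partial\Omega)^\delta}\quad\text{for all }x\in\Omega\text{ with }d(x,\partial\Omega)<r_0,$$ and that there exists $R_0>0$ such that for every $z\in\partial\Omega$ there is a ball of radius at most $R_0$ containing $\Omega$ whose boundary contains $z$. Let $\rho\in(0,1)$ and $L>0$ be constants as described in the context. If $x_0\in\Omega$ and $p_0\in\partial u(x_0)$ are such that $$d(x_0,\partial\Omega)\le\min\Big(\frac{\rho^2}{16(1+4R_0)},\frac{r_0}{2},\frac14\Big),$$ then $$|p_0|\ge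 \Lambda\, d(x_0,\partial\Omega)^{-\frac{1-\delta}{n+2}}-2,$$ where $\Lambda>0$ depends only on $R_0,L,n,\delta$ and $C_0$.
   Context: Points of $\mathbb{S}^n\subset\mathbb{R}^{n+1}$ are written $\bar y=(y,y_{n+1})$; $\mathbb{S}^n_-=\{y_{n+1}<0\}$; geodesically convex means any two points are joined by a minimizing great-circle arc in the set. A function $u$ is $c$-convex if $u(x)=\sup_{(\bar y,\lambda)\in\mathcal{A}}(-c(x,\bar y)+\lambda)$ for some $\mathcal{A}\subset\mathbb{S}^n_-\times\mathbb{R}$ (equivalently convex lower semicontinuous). $\mathrm{c\text{-}exp}_x(p)=\big(\tfrac{p}{\sqrt{1+|p|^2}},-\tfrac{1}{\sqrt{1+|p|^2}}\big)$. A Brenier solution is a $c$-convex $u$ such that $T_u(x)=\mathrm{c\text{-}exp}_x(Du(x))$ minimizes $\int_\Omega c(x,T(x))K(x)dx$ among Borel maps $T$ pushing $K\,dx$ forward to $-y_{n+1}\mathbf{1}_{\Omega^*}d\mathrm{Vol}_{\mathbb{S}^n}$ (measures of equal total mass). $\partial u(x_0)$ is the usual subdifferential of the convex function $u$. The constants $\rho\in(0,1)$, $L>0$ (together with some $C_1>1$) are such that: for each $z\in\partial\Omega$, after a rotation and translation of coordinates, there is an $L$-Lipschitz function $\phi:B^{n-1}_\rho(0)\to(-C_1\rho,C_1\rho)$ with $\mathcal{C}_\rho\cap\Omega=\{(y',y_n)\in\mathcal{C}_\rho\mid y_n>\phi(y')\}$ and $z\in\mathcal{C}_{\rho/2}$,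 where $\mathcal{C}_r=B^{n-1}_r(0)\times(-2C_1r,2C_1r)$ (such constants exist since $\Omega$ is convex and bounded). *)

theory Defs
  imports "HOL-Analysis.Analysis"
begin

text \<open>Points of the sphere S^n in R^(n+1) are pairs (y, y_(n+1)) :: real^'n \<times> real.\<close>

type_synonym 'n pt = "(real^'n) \<times> real"

definition lower_hemisphere :: "'n::finite pt set" where
  "lower_hemisphere = {yb \<in> sphere 0 1. snd yb < 0}"

definition cone01 :: "'n::finite pt set \<Rightarrow> 'n pt set" where
  "cone01 A = {t *\<^sub>R v | t v. v \<in> A \<and> 0 < t \<and> t \<le> 1}"

text \<open>The standard n-dimensional volume measure on S^n (Borel sets), via the classical
  identity Vol_{S^n}(A) = (n+1) * Leb_{n+1}(cone01 A).\<close>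
definition sphere_vol :: "'n::finite pt measure" where
  "sphere_vol = measure_of (sphere 0 1) (sets (restrict_space borel (sphere 0 1)))
      (\<lambda>A. of_nat (CARD('n) + 1) * emeasure lborel (cone01 A))"

definition cost :: "real^'n \<Rightarrow> 'n::finite pt \<Rightarrow> real" where
  "cost x yb = x \<bullet> (fst yb /\<^sub>R snd yb)"

definition c_exp :: "real^'n::finite \<Rightarrow> 'n pt" where
  "c_exp p = (p /\<^sub>R sqrt (1 + (norm p)\<^sup>2), - 1 / sqrt (1 + (norm p)\<^sup>2))"

definition c_convex_on :: "(real^'n::finite) set \<Rightarrow> (real^'n \<Rightarrow> real) \<Rightarrow> bool" where
  "c_convex_on \<Omega> u \<longleftrightarrow> (\<exists>\<A> :: ('n pt \<times> real) set. \<A> \<noteq> {} \<and> \<A> \<subseteq> lower_hemisphere \<times> UNIV \<and>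
     (\<forall>x\<in>\<Omega>. bdd_above ((\<lambda>(yb, l). - cost x yb + l) ` \<A>) \<and>
              u x = (SUP (yb, l)\<in>\<A>. - cost x yb + l)))"

text \<open>Gradient Du(x) (meaningful where u is differentiable) and T_u(x) = c-exp_x(Du(x)).\<close>
definition grad :: "(real^'n::finite \<Rightarrow> real) \<Rightarrow> real^'n \<Rightarrow> real^'n" where
  "grad u x = (SOME p. (u has_derivative (\<lambda>h. p \<bullet> h)) (at x))"

definition T_map :: "(real^'n::finite \<Rightarrow> real) \<Rightarrow> real^'n \<Rightarrow> 'n pt" where
  "T_map u x = c_exp (grad u x)"

definition source_measure :: "(real^'n::finite) set \<Rightarrow> (real^'n \<Rightarrow> real) \<Rightarrow> (real^'n) measure" where
  "source_measure \<Omega> K = density (restrict_space lebesgue \<Omega>) (\<lambda>x. ennreal (K x))"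

definition target_measure :: "'n::finite pt set \<Rightarrow> 'n pt measure" where
  "target_measure \<Omega>s = density sphere_vol (\<lambda>yb. ennreal (- snd yb * indicator \<Omega>s yb))"

definition transport_cost :: "(real^'n::finite) set \<Rightarrow> (real^'n \<Rightarrow> real) \<Rightarrow> (real^'n \<Rightarrow> 'n pt) \<Rightarrow> real" where
  "transport_cost \<Omega> K T = (\<integral>x. cost x (T x) * K x \<partial>(restrict_space lebesgue \<Omega>))"

definition brenier_solution ::
  "(real^'n::finite) set \<Rightarrow> (real^'n \<Rightarrow> real) \<Rightarrow> 'n pt set \<Rightarrow> (real^'n \<Rightarrow> real) \<Rightarrow> bool" where
  "brenier_solution \<Omega> K \<Omega>s u \<longleftrightarrow>
     c_convex_on \<Omega> u \<and>
     T_map u \<in> measurable (restrict_space lebesgue \<Omega>) sphere_vol \<and>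
     distr (source_measure \<Omega> K) sphere_vol (T_map u) = target_measure \<Omega>s \<and>
     (\<forall>T. T \<in> measurable (restrict_space borel \<Omega>) sphere_vol \<longrightarrow>
          distr (source_measure \<Omega> K) sphere_vol T = target_measure \<Omega>s \<longrightarrow>
          transport_cost \<Omega> K (T_map u) \<le> transport_cost \<Omega> K T)"

definition min_geodesic :: "'n::finite pt \<Rightarrow> 'n pt \<Rightarrow> (real \<Rightarrow> 'n pt) \<Rightarrow> bool" where
  "min_geodesic a b \<gamma> \<longleftrightarrow> (\<exists>v. norm v = 1 \<and> a \<bullet> v = 0 \<and>
      (\<forall>t\<in>{0..1}. \<gamma> t = cos (t * arccos (a \<bullet> b)) *\<^sub>R a + sin (t * arccos (a \<bullet> b)) *\<^sub>R v) \<and>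
      \<gamma> 1 = b)"

definition geodesically_convex :: "'n::finite pt set \<Rightarrow> bool" where
  "geodesically_convex S \<longleftrightarrow> S \<subseteq> sphere 0 1 \<and>
     (\<forall>a\<in>S. \<forall>b\<in>S. \<exists>\<gamma>. min_geodesic a b \<gamma> \<and> \<gamma> ` {0..1} \<subseteq> S)"

definition subdiff :: "(real^'n::finite) set \<Rightarrow> (real^'n \<Rightarrow> real) \<Rightarrow> real^'n \<Rightarrow> (real^'n) set" where
  "subdiff \<Omega> u x0 = {p. \<forall>x\<in>\<Omega>. u x \<ge> u x0 + p \<bullet> (x - x0)}"

text \<open>Cylinder C_r in the coordinates centred at b with vertical unit direction e.\<close>
definition cyl :: "real \<Rightarrow> real^'n::finite \<Rightarrow> real^'n \<Rightarrow> real \<Rightarrow> (real^'n) set" where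
  "cyl C1 b e r = {x. norm ((x - b) - ((x - b) \<bullet> e) *\<^sub>R e) < r \<and> \<bar>(x - b) \<bullet> e\<bar> < 2 * C1 * r}"

definition lipschitz_boundary_consts :: "(real^'n::finite) set \<Rightarrow> real \<Rightarrow> real \<Rightarrow> real \<Rightarrow> bool" where
  "lipschitz_boundary_consts \<Omega> \<rho> L C1 \<longleftrightarrow>
     (\<forall>z\<in>frontier \<Omega>. \<exists>b e (\<phi> :: real^'n \<Rightarrow> real).
        norm e = 1 \<and>
        L-lipschitz_on {w. w \<bullet> e = 0 \<and> norm w < \<rho>} \<phi> \<and>
        (\<forall>w. w \<bullet> e = 0 \<and> norm w < \<rho> \<longrightarrow> \<bar>\<phi> w\<bar> < C1 * \<rho>) \<and>
        cyl C1 b e \<rho> \<inter> \<Omega> =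
          {x \<in> cyl C1 b e \<rho>. (x - b) \<bullet> e > \<phi> ((x - b) - ((x - b) \<bullet> e) *\<^sub>R e)} \<and>
        z \<in> cyl C1 b e (\<rho> / 2))"

end

theory Submission
  imports Defs
begin

text \<open>
  In the gnomonic coordinate \<open>p\<close> with \<open>c_exp p = y\<close>, the measure \<open>- y\<^sub>n\<^sub>+\<^sub>1 dVol\<close> on the lower
  hemisphere is \<open>(1 + |p|\<^sup>2) powr (- (n + 2) / 2) dp\<close>, of total mass \<open>\<omega>\<^sub>n\<close>. Hence the target has full
  measure in the hemisphere, and \<open>Du\<close> pushes \<open>K dx\<close> forward to this density on all of \<open>\<real>\<^sup>n\<close>.

  Let \<open>d = d(x\<^sub>0, \<partial>\<Omega>)\<close>, attained at \<open>z\<close>, let \<open>\<nu>\<close> be the outer normal at \<open>z\<close> of the enclosing ball, and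
  consider the slopes \<open>p\<close> within about \<open>\<surd>d\<close> of the segment \<open>p\<^sub>0 + t \<nu>\<close>, \<open>1/2 \<le> t \<le> 1\<close>. Their target mass is at
  least of order \<open>\<surd>d ^ (n - 1) (|p\<^sub>0| + 2) ^ (- (n + 2))\<close>. By monotonicity of the subdifferential they are
  attained only at points \<open>x\<close> with \<open>d(x, \<partial>\<Omega>) < 2 d\<close> and \<open>|x - z| \<le> C \<surd>d\<close>, where the bound on \<open>K\<close> makes the
  source mass at most of order \<open>\<surd>d ^ (n - 1) d powr (1 - \<delta>)\<close>. Comparing the two masses gives the estimate.
\<close>

section \<open>The sphere measure in gnomonic coordinates\<close>

text \<open>This is the norm of (p, -1), the vector whose normalisation is
  \<open>c_exp p\<close>.\<close>

abbreviation hyp :: "'a::real_normed_vector \<Rightarrow> real" where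
  "hyp p \<equiv> sqrt (1 + (norm p)\<^sup>2)"

lemma hyp_pos: "hyp p > 0"
  by (simp add: add_pos_nonneg)

text \<open>The cone is the preimage of \<open>A\<close> under radial projection of the punctured
  unit ball. This is what turns \<open>sphere_vol\<close> into an image measure.\<close>

lemma cone01_eq:
  assumes "A \<subseteq> sphere 0 1"
  shows "cone01 A = {x. x /\<^sub>R norm x \<in> A} \<inter> (cball 0 1 - {0})"
proof (intro set_eqI iffI)
  fix x assume "x \<in> cone01 A"
  then obtain t v where x: "x = t *\<^sub>R v" "v \<in> A" "0 < t" "t \<le> 1"
    by (auto simp: cone01_def)
  moreover have "norm v = 1" using x assms by auto
  ultimately show "x \<in> {x. x /\<^sub>R norm x \<in> A} \<inter> (cball 0 1 - {0})" by auto
next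
  fix x assume "x \<in> {x. x /\<^sub>R norm x \<in> A} \<inter> (cball 0 1 - {0})"
  then show "x \<in> cone01 A"
    unfolding cone01_def
    by (intro CollectI exI[of _ "norm x"] exI[of _ "x /\<^sub>R norm x"]) auto
qed

lemma sets_sphere_vol: "sets (sphere_vol :: 'n::finite pt measure) = sets (restrict_space borel (sphere 0 1))"
  unfolding sphere_vol_def
  using sets.sigma_sets_eq[of "restrict_space borel (sphere 0 1) :: 'n pt measure"]
    sets.space_closed[of "restrict_space borel (sphere 0 1) :: 'n pt measure"]
  by (simp add: space_restrict_space sets_measure_of)

text \<open>\<open>measure_of\<close> yields a measure vanishing everywhere unless the given set
  function is countably additive. Identifying it with a scaled image of Lebesgue measure supplies
  the additivity and opens the way to changes of variables.\<close>

lemma sphere_vol_eq_distr: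
  "(sphere_vol :: 'n::finite pt measure) = scale_measure (of_nat (CARD('n) + 1))
     (distr (restrict_space lborel (cball 0 1 - {0})) (restrict_space borel (sphere 0 1)) (\<lambda>x. x /\<^sub>R norm x))"
  (is "_ = ?M")
proof -
  let ?N = "restrict_space lborel (cball 0 1 - {0}) :: 'n pt measure"
  have meas: "(\<lambda>x. x /\<^sub>R norm x) \<in> measurable ?N (restrict_space borel (sphere 0 1))"
    by (intro measurable_restrict_space2 measurable_restrict_space1) (auto simp: space_restrict_space)
  have "emeasure ?M A = of_nat (CARD('n) + 1) * emeasure lborel (cone01 A)"
    if A: "A \<in> sets (restrict_space borel (sphere 0 1))" for A
  proof -
    have sub: "A \<subseteq> sphere 0 1"
      using sets.sets_into_space[OF A] by (simp add: space_restrict_space)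
    have "emeasure ?M A = of_nat (CARD('n) + 1) * emeasure ?N ((\<lambda>x. x /\<^sub>R norm x) -` A \<inter> space ?N)"
      using meas A by (simp add: emeasure_distr)
    also have "emeasure ?N ((\<lambda>x. x /\<^sub>R norm x) -` A \<inter> space ?N) = emeasure lborel ((\<lambda>x. x /\<^sub>R norm x) -` A \<inter> space ?N)"
      by (rule emeasure_restrict_space) (auto simp: space_restrict_space)
    also have "(\<lambda>x. x /\<^sub>R norm x) -` A \<inter> space ?N = cone01 A"
      unfolding cone01_eq[OF sub] by (auto simp: space_restrict_space)
    finally show ?thesis .
  qed
  note eq = this
  let ?R = "restrict_space borel (sphere 0 1) :: 'n pt measure"
  have sp: "space ?R = sphere 0 1" by (simp add: space_restrict_space)
  have "sphere_vol = measure_of (sphere 0 1) (sets ?R) (emeasure ?M)"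
    unfolding sphere_vol_def
  proof (rule measure_of_eq)
    show "sets ?R \<subseteq> Pow (sphere 0 1)" using sets.space_closed[of ?R] sp by simp
    fix A assume "A \<in> sigma_sets (sphere 0 1) (sets ?R)"
    then have "A \<in> sets ?R" using sets.sigma_sets_eq[of ?R] sp by simp
    then show "of_nat (CARD('n) + 1) * emeasure lborel (cone01 A) = emeasure ?M A" by (simp only: eq)
  qed
  also have "\<dots> = measure_of (space ?M) (sets ?M) (emeasure ?M)"
    by (simp only: space_scale_measure sets_scale_measure space_distr sets_distr sp)
  finally show ?thesis by (simp only: measure_of_of_measure)
qed

lemma borel_measurable_sphere_vol:
  "f \<in> borel_measurable borel \<Longrightarrow> f \<in> borel_measurable sphere_vol"
  unfolding measurable_cong_sets[OF sets_sphere_vol refl] by (rule measurable_restrict_space1)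

lemma nn_integral_sphere_vol:
  fixes f :: "'n::finite pt \<Rightarrow> ennreal"
  assumes [measurable]: "f \<in> borel_measurable borel"
  shows "(\<integral>\<^sup>+y. f y \<partial>sphere_vol) = of_nat (CARD('n) + 1) *
    (\<integral>\<^sup>+x. f (x /\<^sub>R norm x) * indicator (cball 0 1 - {0}) x \<partial>lborel)"
proof -
  let ?N = "restrict_space lborel (cball 0 1 - {0}) :: 'n pt measure"
  have meas: "(\<lambda>x. x /\<^sub>R norm x) \<in> measurable ?N (restrict_space borel (sphere 0 1))"
    by (intro measurable_restrict_space2 measurable_restrict_space1) (auto simp: space_restrict_space)
  have f: "f \<in> borel_measurable (restrict_space borel (sphere 0 1))"
    by (intro measurable_restrict_space1) simp
  have D: "cball 0 1 - {0} \<in> sets (borel :: 'n pt measure)" by (intro sets.Diff) auto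
  have "(\<integral>\<^sup>+y. f y \<partial>sphere_vol) = of_nat (CARD('n) + 1) * (\<integral>\<^sup>+y. f y \<partial>distr ?N (restrict_space borel (sphere 0 1)) (\<lambda>x. x /\<^sub>R norm x))"
    unfolding sphere_vol_eq_distr using f by (intro nn_integral_scale_measure) (simp only: measurable_distr_eq1)
  also have "(\<integral>\<^sup>+y. f y \<partial>distr ?N (restrict_space borel (sphere 0 1)) (\<lambda>x. x /\<^sub>R norm x)) = (\<integral>\<^sup>+x. f (x /\<^sub>R norm x) \<partial>?N)"
    using f by (intro nn_integral_distr[OF meas]) (simp only: measurable_distr_eq1)
  also have "\<dots> = (\<integral>\<^sup>+x. f (x /\<^sub>R norm x) * indicator (cball 0 1 - {0}) x \<partial>lborel)"
    by (rule nn_integral_restrict_space) (use D in simp)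
  finally show ?thesis .
qed

lemma nn_integral_lborel_scale:
  fixes f :: "'a::euclidean_space \<Rightarrow> ennreal"
  assumes [measurable]: "f \<in> borel_measurable borel" and "c \<noteq> 0"
  shows "(\<integral>\<^sup>+x. f x \<partial>lborel) = ennreal (\<bar>c\<bar> ^ DIM('a)) * (\<integral>\<^sup>+x. f (c *\<^sub>R x) \<partial>lborel)"
  by (subst lborel_affine[OF assms(2), of 0])
     (simp add: nn_integral_density nn_integral_distr nn_integral_cmult)

text \<open>The ray through (p, -1) meets height s at (|s| p, s), and its direction is
  \<open>c_exp p\<close>. So (p, s) are coordinates on the lower half space in which radial
  projection forgets s.\<close>

lemma c_exp_eq_normalize:
  assumes "s < 0"
  shows "norm (\<bar>s\<bar> *\<^sub>R p, s) = \<bar>s\<bar> * hyp p" "(\<bar>s\<bar> *\<^sub>R p, s) /\<^sub>R norm (\<bar>s\<bar> *\<^sub>R p, s) = c_exp p"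
proof -
  have "norm (\<bar>s\<bar> *\<^sub>R p, s) = sqrt (s\<^sup>2 * (1 + (norm p)\<^sup>2))"
    by (simp add: norm_Pair power_mult_distrib algebra_simps)
  then show *: "norm (\<bar>s\<bar> *\<^sub>R p, s) = \<bar>s\<bar> * hyp p"
    by (simp add: real_sqrt_mult)
  show "(\<bar>s\<bar> *\<^sub>R p, s) /\<^sub>R norm (\<bar>s\<bar> *\<^sub>R p, s) = c_exp p"
    unfolding * using assms hyp_pos[of p] by (simp add: c_exp_def field_simps)
qed

lemma c_exp_in_lower_hemisphere: "c_exp p \<in> lower_hemisphere"
proof -
  have "c_exp p = sgn (p, - 1)"
    using c_exp_eq_normalize(2)[of "-1" p] unfolding sgn_div_norm by simp
  then have "norm (c_exp p) = 1" by (simp add: norm_sgn zero_prod_def)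
  then show ?thesis using hyp_pos[of p] by (simp add: lower_hemisphere_def c_exp_def)
qed

lemma c_exp_measurable [measurable]: "c_exp \<in> borel_measurable borel"
  unfolding c_exp_def by measurable

lemma nn_integral_power_segment:
  fixes a :: real assumes "a > 0"
  shows "(\<integral>\<^sup>+s. ennreal (\<bar>s\<bar> ^ n) * indicator {-a..<0} s \<partial>lborel) = ennreal (a ^ Suc n / real (Suc n))"
proof -
  have "(\<integral>\<^sup>+s. ennreal (\<bar>s\<bar> ^ n) * indicator {-a..<0} s \<partial>lborel) =
        (\<integral>\<^sup>+s. ennreal ((-s) ^ n) * indicator {-a..0} s \<partial>lborel)"
  proof (rule nn_integral_cong_AE, rule eventually_mono[OF AE_lborel_singleton[of 0]])
    fix s :: real assume "s \<noteq> 0"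
    then show "ennreal (\<bar>s\<bar> ^ n) * indicator {-a..<0} s = ennreal ((-s) ^ n) * indicator {-a..0} s"
      by (cases "s < 0") (simp_all add: indicator_def)
  qed
  also have "\<dots> = ennreal (- ((- 0) ^ Suc n / real (Suc n)) - (- ((- (- a)) ^ Suc n / real (Suc n))))"
  proof (rule nn_integral_FTC_Icc[where F = "\<lambda>x. - ((- x) ^ Suc n / real (Suc n))" and f = "\<lambda>x. (- x) ^ n"])
    fix x :: real
    have "((\<lambda>x. (- x) ^ Suc n) has_real_derivative real (Suc n) * ((- 1) * (- x) ^ n)) (at x)"
      using DERIV_power_Suc[OF DERIV_minus[OF DERIV_ident], of n x UNIV] by simp
    from DERIV_minus[OF DERIV_cdivide[OF this, of "real (Suc n)"]]
    show "((\<lambda>x. - ((- x) ^ Suc n / real (Suc n))) has_real_derivative (- x) ^ n) (at x)"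
      by (simp del: power_Suc of_nat_Suc)
  qed (use assms in auto)
  finally show ?thesis by simp
qed

lemma lower_hemisphere_borel: "(lower_hemisphere :: 'n::finite pt set) \<in> sets borel"
proof -
  have "lower_hemisphere = sphere 0 1 \<inter> {y :: 'n pt. snd y < 0}" by (auto simp: lower_hemisphere_def)
  moreover have "open {y :: 'n pt. snd y < 0}" by (intro open_Collect_less continuous_intros)
  ultimately show ?thesis by (metis borel_closed borel_open closed_sphere sets.Int)
qed

text \<open>The cone is sliced at height s < 0 and each slice is rescaled by q = |s| p, with
  Jacobian |s|^n. After exchanging the integrals, the unit ball restricts s to [-1/hyp p, 0).
  Integrating |s|^n there gives (hyp p)^-(n+1) / (n+1), and the denominator cancels the factor n+1
  in \<open>sphere_vol\<close>.\<close>

lemma nn_integral_lower_hemisphere: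
  fixes f :: "'n::finite pt \<Rightarrow> ennreal"
  assumes [measurable]: "f \<in> borel_measurable borel"
  shows "(\<integral>\<^sup>+y. f y * indicator lower_hemisphere y \<partial>sphere_vol) =
     (\<integral>\<^sup>+p. f (c_exp p) * ennreal (1 / hyp p ^ (CARD('n) + 1)) \<partial>lborel)"
proof -
  let ?n = "CARD('n)"
  note [measurable] = lower_hemisphere_borel
  have D [measurable]: "cball 0 1 - {0} \<in> sets (borel :: 'n pt measure)" by (intro sets.Diff) auto
  define F :: "'n pt \<Rightarrow> ennreal" where
    "F x = f (x /\<^sub>R norm x) * indicator lower_hemisphere (x /\<^sub>R norm x) * indicator (cball 0 1 - {0}) x" for x
  have [measurable]: "F \<in> borel_measurable borel" unfolding F_def by measurable
  have Fm [measurable]: "F \<in> borel_measurable (lborel \<Otimes>\<^sub>M lborel)" by (simp add: lborel_prod)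
  have *: "(\<integral>\<^sup>+q. F (q, s) \<partial>lborel) =
     (\<integral>\<^sup>+p. f (c_exp p) * (ennreal (\<bar>s\<bar> ^ ?n) * indicator {- (1 / hyp p)..<0} s) \<partial>lborel)" for s :: real
  proof (cases "s < 0")
    case True
    have "(\<integral>\<^sup>+q. F (q, s) \<partial>lborel) = ennreal (\<bar>s\<bar> ^ ?n) * (\<integral>\<^sup>+p. F (\<bar>s\<bar> *\<^sub>R p, s) \<partial>lborel)"
      using True nn_integral_lborel_scale[of "\<lambda>q. F (q, s)" "\<bar>s\<bar>"] by simp
    also have "\<dots> = (\<integral>\<^sup>+p. ennreal (\<bar>s\<bar> ^ ?n) * F (\<bar>s\<bar> *\<^sub>R p, s) \<partial>lborel)"
      by (rule nn_integral_cmult[symmetric]) measurable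
    also have "\<dots> = (\<integral>\<^sup>+p. f (c_exp p) * (ennreal (\<bar>s\<bar> ^ ?n) * indicator {- (1 / hyp p)..<0} s) \<partial>lborel)"
    proof (intro nn_integral_cong)
      fix p :: "real^'n"
      have "(\<bar>s\<bar> *\<^sub>R p, s) \<in> cball 0 1 - {0} \<longleftrightarrow> norm (\<bar>s\<bar> *\<^sub>R p, s) \<le> 1"
        using True by (simp add: prod_eq_iff)
      then have "(\<bar>s\<bar> *\<^sub>R p, s) \<in> cball 0 1 - {0} \<longleftrightarrow> s \<in> {- (1 / hyp p)..<0}"
        using True hyp_pos[of p] c_exp_eq_normalize(1)[OF True, of p]
        by (simp add: minus_le_iff le_divide_eq)
      then show "ennreal (\<bar>s\<bar> ^ ?n) * F (\<bar>s\<bar> *\<^sub>R p, s) =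
          f (c_exp p) * (ennreal (\<bar>s\<bar> ^ ?n) * indicator {- (1 / hyp p)..<0} s)"
        unfolding F_def c_exp_eq_normalize(2)[OF True]
        by (simp add: indicator_def c_exp_in_lower_hemisphere mult.commute)
    qed
    finally show ?thesis .
  next
    case False
    then have "F (q, s) = 0" for q
      by (simp add: F_def indicator_def lower_hemisphere_def mult_less_0_iff)
    with False show ?thesis by simp
  qed
  have "(\<integral>\<^sup>+y. f y * indicator lower_hemisphere y \<partial>sphere_vol) = of_nat (?n + 1) * (\<integral>\<^sup>+x. F x \<partial>lborel)"
    unfolding F_def by (rule nn_integral_sphere_vol) measurable
  also have "(\<integral>\<^sup>+x. F x \<partial>lborel) = (\<integral>\<^sup>+s. (\<integral>\<^sup>+q. F (q, s) \<partial>lborel) \<partial>lborel)"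
    by (subst lborel_pair.nn_integral_snd) (auto simp: lborel_prod)
  also have "\<dots> = (\<integral>\<^sup>+s. (\<integral>\<^sup>+p. f (c_exp p) * (ennreal (\<bar>s\<bar> ^ ?n) * indicator {- (1 / hyp p)..<0} s) \<partial>lborel) \<partial>lborel)"
    unfolding * ..
  also have "\<dots> = (\<integral>\<^sup>+p. (\<integral>\<^sup>+s. f (c_exp p) * (ennreal (\<bar>s\<bar> ^ ?n) * indicator {- (1 / hyp p)..<0} s) \<partial>lborel) \<partial>lborel)"
    by (rule lborel_pair.Fubini') (unfold indicator_def atLeastLessThan_iff, measurable)
  also have "\<dots> = (\<integral>\<^sup>+p. f (c_exp p) * ennreal ((1 / hyp p) ^ Suc ?n / real (Suc ?n)) \<partial>lborel)"
  proof (intro nn_integral_cong)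
    fix p :: "real^'n"
    show "(\<integral>\<^sup>+s. f (c_exp p) * (ennreal (\<bar>s\<bar> ^ ?n) * indicator {- (1 / hyp p)..<0} s) \<partial>lborel) =
        f (c_exp p) * ennreal ((1 / hyp p) ^ Suc ?n / real (Suc ?n))"
      using nn_integral_power_segment[of "1 / hyp p" ?n] hyp_pos[of p]
      by (subst nn_integral_cmult) auto
  qed
  also have "of_nat (?n + 1) * \<dots> =
     (\<integral>\<^sup>+p. of_nat (?n + 1) * (f (c_exp p) * ennreal ((1 / hyp p) ^ Suc ?n / real (Suc ?n))) \<partial>lborel)"
    by (rule nn_integral_cmult[symmetric]) measurable
  also have "\<dots> = (\<integral>\<^sup>+p. f (c_exp p) * ennreal (1 / hyp p ^ (?n + 1)) \<partial>lborel)"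
  proof (intro nn_integral_cong)
    fix p :: "real^'n"
    have "(of_nat (?n + 1) :: ennreal) * ennreal ((1 / hyp p) ^ Suc ?n / real (Suc ?n)) = ennreal (1 / hyp p ^ (?n + 1))"
      unfolding ennreal_of_nat_eq_real_of_nat
      by (subst ennreal_mult'[symmetric]) (auto simp: power_one_over simp del: of_nat_Suc power_Suc)
    then show "of_nat (?n + 1) * (f (c_exp p) * ennreal ((1 / hyp p) ^ Suc ?n / real (Suc ?n))) = f (c_exp p) * ennreal (1 / hyp p ^ (?n + 1))"
      by (metis mult.left_commute)
  qed
  finally show ?thesis .
qed

lemma DERIV_inverse_sqrt_one_plus_square:
  "((\<lambda>r. 1 / sqrt (1 + r\<^sup>2)) has_real_derivative - (r * (1 / sqrt (1 + r\<^sup>2)) ^ 3)) (at r)"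
proof -
  have pos: "1 + r\<^sup>2 > 0" by (simp add: add_pos_nonneg)
  then have s: "sqrt (1 + r\<^sup>2) > 0" by simp
  have "((\<lambda>r. sqrt (1 + r\<^sup>2)) has_real_derivative r / sqrt (1 + r\<^sup>2)) (at r)"
    using pos by (auto intro!: derivative_eq_intros simp: field_simps)
  from DERIV_inverse'[OF this] s show ?thesis
    by (simp add: divide_inverse power3_eq_cube ac_simps)
qed

text \<open>Layer-cake argument: the radial integrand is an integral over r \<ge> |p|, so exchanging
  integrals brings in the volume of the ball of radius r. The remaining one-dimensional integrand
  has the antiderivative (r * k r)^(n+2), which rises from 0 to 1.\<close>

lemma nn_integral_hyp_power:
  "(\<integral>\<^sup>+p. ennreal (1 / hyp (p::'a::euclidean_space) ^ (DIM('a) + 2)) \<partial>lborel) = ennreal (unit_ball_vol (real DIM('a)))"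
proof -
  let ?n = "DIM('a)"
  define k where "k r = 1 / sqrt (1 + r\<^sup>2)" for r :: real
  have k_deriv: "(k has_real_derivative - (r * k r ^ 3)) (at r)" for r
    using DERIV_inverse_sqrt_one_plus_square[of r] by (simp add: k_def[abs_def])
  have k_pos: "k r > 0" for r by (simp add: k_def add_pos_nonneg)
  have k_sq: "(1 + r\<^sup>2) * (k r)\<^sup>2 = 1" for r
    using add_pos_nonneg[of 1 "r\<^sup>2"] by (simp add: k_def power_divide)
  have [measurable]: "k \<in> borel_measurable borel" unfolding k_def[abs_def] by measurable
  have k_lim: "(k \<longlongrightarrow> 0) at_top"
    unfolding k_def[abs_def]
    by (intro tendsto_divide_0[OF tendsto_const] filterlim_at_top_imp_at_infinity
        filterlim_compose[OF sqrt_at_top] filterlim_tendsto_add_at_top[OF tendsto_const]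
        filterlim_pow_at_top filterlim_ident) simp
  have rk_lim: "((\<lambda>r. r * k r) \<longlongrightarrow> 1) at_top"
  proof -
    have "((\<lambda>r. sqrt (1 - (k r)\<^sup>2)) \<longlongrightarrow> sqrt (1 - 0\<^sup>2)) at_top"
      by (intro tendsto_intros k_lim)
    moreover have "\<forall>\<^sub>F r in at_top. sqrt (1 - (k r)\<^sup>2) = r * k r"
      using eventually_ge_at_top[of 0]
    proof eventually_elim
      case (elim r)
      have "1 - (k r)\<^sup>2 = (r * k r)\<^sup>2" using k_sq[of r] by (simp add: power_mult_distrib algebra_simps)
      then show ?case using elim k_pos[of r] by simp
    qed
    ultimately show ?thesis by (simp add: filterlim_cong[OF refl refl])
  qed
  \<comment> \<open>\<open>g\<close> is the derivative of -k^(n+2), and k tends to 0, so integrating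
    \<open>g\<close> from |p| to infinity returns the original integrand.\<close>
  define g where "g r = real (?n + 2) * k r ^ (?n + 1) * (r * k r ^ 3)" for r
  have [measurable]: "g \<in> borel_measurable borel" unfolding g_def[abs_def] by measurable
  have "ennreal (1 / hyp p ^ (?n + 2)) = (\<integral>\<^sup>+r. ennreal (g r) * indicator {norm (p::'a)..} r \<partial>lborel)" for p :: 'a
  proof -
    have "((\<lambda>r. - (k r ^ (?n + 2))) has_real_derivative g r) (at r)" for r
      using DERIV_minus[OF DERIV_power[OF k_deriv[of r], of "?n + 2"]] by (simp add: g_def ac_simps)
    moreover have "g r \<ge> 0" if "norm p \<le> r" for r
      using order_trans[OF norm_ge_zero that] k_pos[of r] unfolding g_def by (intro mult_nonneg_nonneg) auto
    moreover have "((\<lambda>r. - (k r ^ (?n + 2))) \<longlongrightarrow> 0) at_top"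
      using tendsto_minus[OF tendsto_power[OF k_lim, of "?n + 2"]] by simp
    ultimately have "(\<integral>\<^sup>+r. ennreal (g r) * indicator {norm (p::'a)..} r \<partial>lborel) = ennreal (0 - (- (k (norm p) ^ (?n + 2))))"
      by (intro nn_integral_FTC_atLeast) auto
    then show ?thesis by (simp add: k_def power_one_over power_divide)
  qed
  then have "(\<integral>\<^sup>+p. ennreal (1 / hyp (p::'a) ^ (?n + 2)) \<partial>lborel) =
      (\<integral>\<^sup>+p. (\<integral>\<^sup>+r. ennreal (g r) * indicator {norm (p::'a)..} r \<partial>lborel) \<partial>lborel)"
    by simp
  also have "\<dots> = (\<integral>\<^sup>+r. (\<integral>\<^sup>+p. ennreal (g r) * indicator {norm (p::'a)..} r \<partial>lborel) \<partial>lborel)"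
    by (rule lborel_pair.Fubini') (unfold indicator_def atLeast_iff, measurable)
  also have "\<dots> = (\<integral>\<^sup>+r. ennreal (unit_ball_vol (real ?n)) *
      (ennreal (real (?n + 2) * (r * k r) ^ (?n + 1) * k r ^ 3) * indicator {0..} r) \<partial>lborel)"
  proof (intro nn_integral_cong)
    fix r :: real
    have "(\<integral>\<^sup>+p. ennreal (g r) * indicator {norm (p::'a)..} r \<partial>lborel) = (\<integral>\<^sup>+p. ennreal (g r) * indicator (cball (0::'a) r) p \<partial>lborel)"
      by (intro nn_integral_cong) (simp add: indicator_def)
    also have "\<dots> = ennreal (g r) * emeasure lborel (cball (0::'a) r)"
      by (simp add: nn_integral_cmult_indicator)
    also have "\<dots> = ennreal (unit_ball_vol (real ?n)) *
      (ennreal (real (?n + 2) * (r * k r) ^ (?n + 1) * k r ^ 3) * indicator {0..} r)"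
    proof (cases "r \<ge> 0")
      case True
      have "g r * (unit_ball_vol (real ?n) * r ^ ?n) = unit_ball_vol (real ?n) * (real (?n + 2) * (r * k r) ^ (?n + 1) * k r ^ 3)"
        by (simp add: g_def power_mult_distrib)
      moreover have "g r \<ge> 0" unfolding g_def using True k_pos[of r] by (intro mult_nonneg_nonneg) auto
      moreover have "emeasure lborel (cball (0::'a) r) = ennreal (unit_ball_vol (real ?n) * r ^ ?n)"
        using True by (rule emeasure_cball)
      ultimately show ?thesis
        using True by (simp only: ennreal_mult'[symmetric] unit_ball_vol_nonneg indicator_simps atLeast_iff mult_1_right of_nat_0_le_iff)
    qed simp
    finally show "(\<integral>\<^sup>+p. ennreal (g r) * indicator {norm (p::'a)..} r \<partial>lborel) = \<dots>" .
  qed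
  also have "\<dots> = ennreal (unit_ball_vol (real ?n)) *
      (\<integral>\<^sup>+r. ennreal (real (?n + 2) * (r * k r) ^ (?n + 1) * k r ^ 3) * indicator {0..} r \<partial>lborel)"
    by (rule nn_integral_cmult) measurable
  also have "(\<integral>\<^sup>+r. ennreal (real (?n + 2) * (r * k r) ^ (?n + 1) * k r ^ 3) * indicator {0..} r \<partial>lborel)
     = ennreal (1 - (0 * k 0) ^ (?n + 2))"
  proof (rule nn_integral_FTC_atLeast)
    fix r :: real assume r: "0 \<le> r"
    show "0 \<le> real (?n + 2) * (r * k r) ^ (?n + 1) * k r ^ 3"
      using r k_pos[of r] by (intro mult_nonneg_nonneg) auto
    \<comment> \<open>Since (1 + r^2) k^2 = 1, the product rule gives (r k)' = k - r^2 k^3 =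
      k^3.\<close>
    have "k r - r * (r * k r ^ 3) = k r ^ 3"
    proof -
      have "k r - r * (r * k r ^ 3) = k r * ((1 + r\<^sup>2) * (k r)\<^sup>2) - r * (r * k r ^ 3)" by (simp only: k_sq mult_1_right)
      then show ?thesis by (simp add: algebra_simps power2_eq_square power3_eq_cube)
    qed
    then have "((\<lambda>r. r * k r) has_real_derivative k r ^ 3) (at r)"
      by (intro DERIV_cong[OF DERIV_mult[OF DERIV_ident k_deriv]]) (simp add: ac_simps)
    from DERIV_power[OF this, of "?n + 2"]
    show "((\<lambda>r. (r * k r) ^ (?n + 2)) has_real_derivative real (?n + 2) * (r * k r) ^ (?n + 1) * k r ^ 3) (at r)"
      by (simp add: ac_simps)
  next
    show "((\<lambda>r. (r * k r) ^ (?n + 2)) \<longlongrightarrow> 1) at_top"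
      using tendsto_power[OF rk_lim, of "?n + 2"] by simp
  qed measurable
  finally show ?thesis by simp
qed

section \<open>The target measure as a density over slopes\<close>

definition gnomonic :: "'n::finite pt \<Rightarrow> real^'n" where
  "gnomonic y = fst y /\<^sub>R (- snd y)"

lemma gnomonic_c_exp [simp]: "gnomonic (c_exp p) = p"
  using hyp_pos[of p] by (simp add: gnomonic_def c_exp_def)

lemma c_exp_gnomonic: "y \<in> lower_hemisphere \<Longrightarrow> c_exp (gnomonic y) = y"
proof -
  assume y: "y \<in> lower_hemisphere"
  then have s: "snd y < 0" and n: "norm y = 1" by (auto simp: lower_hemisphere_def)
  have "(\<bar>snd y\<bar> *\<^sub>R gnomonic y, snd y) = y"
    using s by (simp add: gnomonic_def prod_eq_iff)
  then show ?thesis using c_exp_eq_normalize(2)[OF s, of "gnomonic y"] n by simp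
qed

text \<open>\<open>gnomonic\<close> is the central projection to height -1 and inverts
  \<open>c_exp\<close> on the lower hemisphere, so the image is a preimage under a Borel
  map.\<close>

lemma c_exp_image_borel:
  fixes P :: "(real^'n::finite) set"
  assumes "P \<in> sets borel"
  shows "c_exp ` P \<in> sets borel"
proof -
  have "c_exp ` P = lower_hemisphere \<inter> gnomonic -` P"
  proof (intro set_eqI iffI)
    fix y assume "y \<in> lower_hemisphere \<inter> gnomonic -` P"
    then show "y \<in> c_exp ` P" using c_exp_gnomonic[of y] by (intro image_eqI[of _ _ "gnomonic y"]) auto
  qed (auto simp: c_exp_in_lower_hemisphere)
  moreover have "gnomonic \<in> borel_measurable (borel :: 'n pt measure)"
  proof -
    have [measurable]: "fst \<in> borel_measurable (borel :: 'n pt measure)" "snd \<in> borel_measurable (borel :: 'n pt measure)"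
      by (auto intro!: borel_measurable_continuous_onI continuous_intros)
    show ?thesis unfolding gnomonic_def by measurable
  qed
  ultimately show ?thesis
    using sets.Int[OF lower_hemisphere_borel measurable_sets_borel[OF _ assms]] by simp
qed

lemma sets_sphere_vol_iff: "A \<in> sets sphere_vol \<longleftrightarrow> A \<in> sets borel \<and> A \<subseteq> sphere 0 1"
  unfolding sets_sphere_vol by (subst sets_restrict_space_iff) (simp_all add: conj_commute)

lemma c_exp_image_sphere_vol:
  assumes "P \<in> sets borel"
  shows "c_exp ` P \<in> sets sphere_vol"
proof -
  have "c_exp ` P \<subseteq> lower_hemisphere" using c_exp_in_lower_hemisphere by blast
  also have "\<dots> \<subseteq> sphere 0 1" unfolding lower_hemisphere_def by blast
  finally show ?thesis
    using c_exp_image_borel[OF assms] unfolding sets_sphere_vol_iff by blast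
qed

text \<open>The last coordinate of \<open>c_exp p\<close> is -1/hyp p, so the weight raises the
  exponent of the hemisphere formula from n+1 to n+2.\<close>

lemma nn_integral_height_lower_hemisphere:
  fixes A :: "'n::finite pt set"
  assumes [measurable]: "A \<in> sets borel"
  shows "(\<integral>\<^sup>+y. ennreal (- snd y) * indicator A y * indicator lower_hemisphere y \<partial>sphere_vol) =
    (\<integral>\<^sup>+p. ennreal (1 / hyp p ^ (CARD('n) + 2)) * indicator A (c_exp p) \<partial>lborel)"
proof -
  have [measurable]: "snd \<in> borel_measurable (borel :: 'n pt measure)"
    by (auto intro!: borel_measurable_continuous_onI continuous_intros)
  have "(\<integral>\<^sup>+y. ennreal (- snd y) * indicator A y * indicator lower_hemisphere y \<partial>sphere_vol) =
    (\<integral>\<^sup>+p. ennreal (- snd (c_exp p)) * indicator A (c_exp p) * ennreal (1 / hyp p ^ (CARD('n) + 1)) \<partial>lborel)"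
    by (rule nn_integral_lower_hemisphere) measurable
  also have "\<dots> = (\<integral>\<^sup>+p. ennreal (1 / hyp p ^ (CARD('n) + 2)) * indicator A (c_exp p) \<partial>lborel)"
  proof (rule nn_integral_cong)
    fix p :: "real^'n"
    have eq: "ennreal (- snd (c_exp p)) * ennreal (1 / hyp p ^ (CARD('n) + 1)) = ennreal (1 / hyp p ^ (CARD('n) + 2))"
      using hyp_pos[of p] by (subst ennreal_mult[symmetric]) (auto simp: c_exp_def)
    show "ennreal (- snd (c_exp p)) * indicator A (c_exp p) * ennreal (1 / hyp p ^ (CARD('n) + 1)) =
        ennreal (1 / hyp p ^ (CARD('n) + 2)) * indicator A (c_exp p)"
      unfolding eq[symmetric] by (simp only: ac_simps)
  qed
  finally show ?thesis .
qed

text \<open>The total mass \<open>\<omega>\<^sub>n\<close> is that of the whole open hemisphere, so \<open>\<Omega>s\<close> exhausts it up to a null set.\<close>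

lemma AE_c_exp_in_full_mass:
  fixes \<Omega>s :: "'n::finite pt set"
  assumes \<Omega>s: "\<Omega>s \<in> sets sphere_vol" "\<Omega>s \<subseteq> lower_hemisphere"
    and mass: "(\<integral>yb\<in>\<Omega>s. - snd yb \<partial>sphere_vol) = measure lborel (ball (0::real^'n) 1)"
  shows "AE p in lborel. c_exp p \<in> \<Omega>s"
proof -
  have [measurable]: "\<Omega>s \<in> sets borel" using \<Omega>s sets_sphere_vol_iff by blast
  define \<omega> where "\<omega> = measure lborel (ball (0::real^'n) 1)"
  have \<omega>: "\<omega> > 0" "\<omega> = unit_ball_vol (real CARD('n))"
    by (auto simp: \<omega>_def content_ball)
  let ?I = "\<lambda>A. (\<integral>\<^sup>+p. ennreal (1 / hyp (p::real^'n) ^ (CARD('n) + 2)) * indicator A (c_exp p) \<partial>lborel)"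
  let ?f = "\<lambda>y. indicator \<Omega>s y *\<^sub>R (- snd y)"
  \<comment> \<open>The Bochner integral of a non-integrable function is 0 by convention, whereas
    here it equals \<omega> > 0.\<close>
  have int: "integrable sphere_vol ?f"
    using mass \<omega>(1) not_integrable_integral_eq unfolding set_lebesgue_integral_def \<omega>_def by fastforce
  have "(\<integral>\<^sup>+y. ennreal (?f y) \<partial>sphere_vol) = ennreal (\<integral>y. ?f y \<partial>sphere_vol)"
    using \<Omega>s(2) by (intro nn_integral_eq_integral int AE_I2) (auto simp: indicator_def lower_hemisphere_def)
  also have "(\<integral>\<^sup>+y. ennreal (?f y) \<partial>sphere_vol) =
      (\<integral>\<^sup>+y. ennreal (- snd y) * indicator \<Omega>s y * indicator lower_hemisphere y \<partial>sphere_vol)"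
    using \<Omega>s(2) by (intro nn_integral_cong) (auto simp: indicator_def)
  finally have 1: "?I \<Omega>s = ennreal \<omega>"
    using mass nn_integral_height_lower_hemisphere[of \<Omega>s] by (simp add: set_lebesgue_integral_def \<omega>_def)
  have 2: "?I UNIV = ennreal \<omega>"
    using nn_integral_hyp_power[where 'a = "real^'n"] \<omega>(2) by simp
  have "?I UNIV = (\<integral>\<^sup>+p. ennreal (1 / hyp p ^ (CARD('n) + 2)) * indicator \<Omega>s (c_exp p)
      + ennreal (1 / hyp p ^ (CARD('n) + 2)) * indicator (- \<Omega>s) (c_exp p) \<partial>lborel)"
    by (intro nn_integral_cong) (auto simp: indicator_def)
  also have "\<dots> = ?I \<Omega>s + ?I (- \<Omega>s)"
    by (rule nn_integral_add) measurable
  \<comment> \<open>The slopes mapped outside \<Omega>s carry the difference of two equal finite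
    masses, that is, none. As the density is positive, they form a null set.\<close>
  finally have "ennreal \<omega> + 0 = ennreal \<omega> + ?I (- \<Omega>s)" using 1 2 by simp
  then have "?I (- \<Omega>s) = 0" by (subst (asm) ennreal_add_left_cancel) auto
  then have "AE p in lborel. ennreal (1 / hyp p ^ (CARD('n) + 2)) * indicator (- \<Omega>s) (c_exp p) = (0 :: ennreal)"
    by (subst (asm) nn_integral_0_iff_AE) measurable
  then show ?thesis
  proof (rule eventually_mono)
    fix p :: "real^'n"
    assume "ennreal (1 / hyp p ^ (CARD('n) + 2)) * indicator (- \<Omega>s) (c_exp p) = (0 :: ennreal)"
    then show "c_exp p \<in> \<Omega>s" using hyp_pos[of p] by (auto simp: indicator_def split: if_splits)
  qed
qed

text \<open>Almost every slope is mapped into \<Omega>s, so its indicator drops out and the target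
  becomes an explicit density on all of the slope space.\<close>

lemma emeasure_target_c_exp_image:
  fixes \<Omega>s :: "'n::finite pt set"
  assumes \<Omega>s: "\<Omega>s \<in> sets sphere_vol" "\<Omega>s \<subseteq> lower_hemisphere"
    and mass: "(\<integral>yb\<in>\<Omega>s. - snd yb \<partial>sphere_vol) = measure lborel (ball (0::real^'n) 1)"
    and P: "P \<in> sets borel"
  shows "emeasure (target_measure \<Omega>s) (c_exp ` P) = (\<integral>\<^sup>+p\<in>P. ennreal (1 / hyp p ^ (CARD('n) + 2)) \<partial>lborel)"
proof -
  have [measurable]: "\<Omega>s \<in> sets borel" using \<Omega>s sets_sphere_vol_iff by blast
  note [measurable] = c_exp_image_borel[OF P]
  have "c_exp ` P \<in> sets sphere_vol" by (rule c_exp_image_sphere_vol[OF P])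
  then have "emeasure (target_measure \<Omega>s) (c_exp ` P) =
      (\<integral>\<^sup>+y. ennreal (- snd y * indicator \<Omega>s y) * indicator (c_exp ` P) y \<partial>sphere_vol)"
    unfolding target_measure_def
    by (intro emeasure_density borel_measurable_sphere_vol measurable_compose[OF _ measurable_ennreal] borel_measurable_times
        borel_measurable_uminus borel_measurable_indicator) (auto intro!: borel_measurable_continuous_onI continuous_intros)
  also have "\<dots> = (\<integral>\<^sup>+y. ennreal (- snd y) * indicator (\<Omega>s \<inter> c_exp ` P) y * indicator lower_hemisphere y \<partial>sphere_vol)"
    using \<Omega>s(2) by (intro nn_integral_cong) (auto simp: indicator_def)
  also have "\<dots> = (\<integral>\<^sup>+p. ennreal (1 / hyp p ^ (CARD('n) + 2)) * indicator (\<Omega>s \<inter> c_exp ` P) (c_exp p) \<partial>lborel)"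
    by (rule nn_integral_height_lower_hemisphere) measurable
  also have "\<dots> = (\<integral>\<^sup>+p\<in>P. ennreal (1 / hyp p ^ (CARD('n) + 2)) \<partial>lborel)"
  proof (rule nn_integral_cong_AE, rule eventually_mono[OF AE_c_exp_in_full_mass[OF \<Omega>s mass]])
    fix p :: "real^'n" assume "c_exp p \<in> \<Omega>s"
    moreover have "c_exp p \<in> c_exp ` P \<longleftrightarrow> p \<in> P" by (metis gnomonic_c_exp image_iff)
    ultimately show "ennreal (1 / hyp p ^ (CARD('n) + 2)) * indicator (\<Omega>s \<inter> c_exp ` P) (c_exp p) =
        ennreal (1 / hyp p ^ (CARD('n) + 2)) * indicator P p"
      by (simp add: indicator_def)
  qed
  finally show ?thesis .
qed

section \<open>Boundary layers of convex sets\<close>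

text \<open>Let w be a separating normal at a nearest frontier point y. If all points x \<plusminus>
  n s b stayed in \<Omega>, then n s |w \<bullet> b| \<le> w \<bullet> (y - x) for every b. Summing
  over the n basis vectors and cancelling n bounds s times the l1 norm of w by w \<bullet> (y - x),
  which is less than s |w|.\<close>

lemma frontier_close_imp_basis_exit:
  fixes \<Omega> :: "'a::euclidean_space set"
  assumes "convex \<Omega>" "open \<Omega>" "x \<in> \<Omega>" "frontier \<Omega> \<noteq> {}" and s: "infdist x (frontier \<Omega>) < s"
  shows "\<exists>b\<in>Basis. x + (real DIM('a) * s) *\<^sub>R b \<notin> \<Omega> \<or> x - (real DIM('a) * s) *\<^sub>R b \<notin> \<Omega>"
proof (rule ccontr)
  let ?c = "real DIM('a) * s"
  assume "\<not> ?thesis"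
  then have in\<Omega>: "x + ?c *\<^sub>R b \<in> \<Omega>" "x - ?c *\<^sub>R b \<in> \<Omega>" if "b \<in> Basis" for b
    using that by auto
  obtain y where y: "y \<in> frontier \<Omega>" "infdist x (frontier \<Omega>) = dist x y"
    using infdist_attains_inf[of "frontier \<Omega>" x] assms by auto
  have "y \<notin> \<Omega>"
    using y assms(2) by (simp add: frontier_def interior_open)
  then obtain w \<beta> where w: "w \<noteq> 0" "\<forall>x\<in>\<Omega>. w \<bullet> x \<le> \<beta>" "\<beta> \<le> w \<bullet> y"
    using separating_hyperplane_sets[of \<Omega> "{y}"] assms by auto
  have "?c * \<bar>w \<bullet> b\<bar> \<le> w \<bullet> (y - x)" if "b \<in> Basis" for b
  proof -
    have "w \<bullet> (x + ?c *\<^sub>R b) \<le> w \<bullet> y" "w \<bullet> (x - ?c *\<^sub>R b) \<le> w \<bullet> y"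
      using w in\<Omega>[OF that] by fastforce+
    then show ?thesis by (auto simp: inner_add_right inner_diff_right abs_if)
  qed
  then have "(\<Sum>b\<in>Basis. ?c * \<bar>w \<bullet> b\<bar>) \<le> (\<Sum>b\<in>(Basis::'a set). w \<bullet> (y - x))"
    by (rule sum_mono)
  then have "real DIM('a) * (s * (\<Sum>b\<in>Basis. \<bar>w \<bullet> b\<bar>)) \<le> real DIM('a) * (w \<bullet> (y - x))"
    by (simp add: sum_distrib_left mult.assoc)
  then have "s * (\<Sum>b\<in>Basis. \<bar>w \<bullet> b\<bar>) \<le> w \<bullet> (y - x)"
    by simp
  moreover have "s * norm w \<le> s * (\<Sum>b\<in>Basis. \<bar>w \<bullet> b\<bar>)"
    using norm_le_l1[of w] s infdist_nonneg[of x "frontier \<Omega>"] by (intro mult_left_mono) auto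
  moreover have "w \<bullet> (y - x) \<le> norm w * norm (y - x)"
    by (rule norm_cauchy_schwarz)
  moreover have "norm w * norm (y - x) < norm w * s"
    using w s y by (intro mult_strict_left_mono) (auto simp: dist_norm norm_minus_commute)
  ultimately show False by (simp add: mult.commute)
qed

text \<open>Stacking about \<open>2 R / a\<close> disjoint translates of \<open>S\<close> inside one box bounds the measure of \<open>S\<close>
  without slicing it.\<close>

lemma emeasure_disjoint_translates_le:
  fixes S :: "'a::euclidean_space set"
  assumes [measurable]: "S \<in> sets borel" and sub: "S \<subseteq> cball z R" and b: "b \<in> Basis"
    and "a > 0" "R > 0"
    and disj: "\<And>x m. x \<in> S \<Longrightarrow> (m::nat) \<ge> 1 \<Longrightarrow> x + (real m * a) *\<^sub>R b \<notin> S"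
  shows "emeasure lborel S \<le> ennreal (2 * a * (2 * R) ^ (DIM('a) - 1))"
proof -
  \<comment> \<open>With N a \<ge> 2 R the box containing all N translates has long side 2 R + N a
    \<le> 2 N a. Dividing by N then leaves a bound proportional to a.\<close>
  define N where "N = nat \<lceil>2 * R / a\<rceil>"
  have N: "2 * R \<le> real N * a"
    using real_nat_ceiling_ge[of "2 * R / a"] \<open>a > 0\<close> by (simp add: N_def field_simps)
  then have "N > 0" using assms by (cases N) auto
  define T where "T k = {y. - (real k * a) *\<^sub>R b + y \<in> S}" for k :: nat
  have [measurable]: "T k \<in> sets borel" for k unfolding T_def by measurable
  have T: "emeasure lborel (T k) = emeasure lborel S" for k
  proof -
    have "emeasure lborel S = emeasure (distr lborel borel (\<lambda>y. - (real k * a) *\<^sub>R b + y)) S"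
      by (simp only: lborel_distr_plus)
    also have "\<dots> = emeasure lborel (T k)"
      by (subst emeasure_distr) (auto simp: T_def vimage_def)
    finally show ?thesis ..
  qed
  have "disjoint_family_on T {..<N}"
  proof -
    have "T k \<inter> T m = {}" if "k < m" for k m
    proof (rule equals0I)
      fix y assume "y \<in> T k \<inter> T m"
      then have y: "- (real k * a) *\<^sub>R b + y \<in> S" "- (real m * a) *\<^sub>R b + y \<in> S" by (auto simp: T_def)
      have "- (real m * a) *\<^sub>R b + y + (real (m - k) * a) *\<^sub>R b = - (real k * a) *\<^sub>R b + y"
        using that by (simp add: of_nat_diff algebra_simps)
      then show False using disj[OF y(2), of "m - k"] y(1) that
        by (metis One_nat_def Suc_leI zero_less_diff)
    qed
    then show ?thesis
      unfolding disjoint_family_on_def by (metis inf_commute linorder_neqE_nat)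
  qed
  then have "(\<Sum>k<N. emeasure lborel (T k)) = emeasure lborel (\<Union>k<N. T k)"
    by (intro sum_emeasure) auto
  also have "\<dots> \<le> emeasure lborel (cbox (z - R *\<^sub>R One) (z + R *\<^sub>R One + (real N * a) *\<^sub>R b))"
  proof (intro emeasure_mono subsetI)
    fix y assume "y \<in> (\<Union>k<N. T k)"
    then obtain k where k: "k < N" "- (real k * a) *\<^sub>R b + y \<in> S" by (auto simp: T_def)
    let ?x = "- (real k * a) *\<^sub>R b + y"
    have "norm (?x - z) \<le> R" using k(2) sub by (auto simp: dist_norm norm_minus_commute)
    then have xz: "\<bar>(?x - z) \<bullet> i\<bar> \<le> R" if "i \<in> Basis" for i
      using Basis_le_norm[OF that, of "?x - z"] by linarith
    have ka: "0 \<le> real k * a" "real k * a \<le> real N * a"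
      using k(1) \<open>a > 0\<close> by auto
    show "y \<in> cbox (z - R *\<^sub>R One) (z + R *\<^sub>R One + (real N * a) *\<^sub>R b)"
      unfolding mem_box
    proof
      fix i :: 'a assume i: "i \<in> Basis"
      show "(z - R *\<^sub>R One) \<bullet> i \<le> y \<bullet> i \<and> y \<bullet> i \<le> (z + R *\<^sub>R One + (real N * a) *\<^sub>R b) \<bullet> i"
        using xz[OF i] ka b i
        by (cases "i = b") (auto simp: inner_simps inner_not_same_Basis abs_le_iff inner_Basis)
    qed
  qed auto
  also have "\<dots> = ennreal ((2 * R + real N * a) * (2 * R) ^ (DIM('a) - 1))"
  proof -
    let ?u = "z + R *\<^sub>R One + (real N * a) *\<^sub>R b" and ?l = "z - R *\<^sub>R One"
    have eq: "(?u - ?l) \<bullet> i = (if i = b then 2 * R + real N * a else 2 * R)" if "i \<in> Basis" for i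
      using that b by (auto simp: inner_simps inner_Basis)
    have pos: "real N * a \<ge> 0" using \<open>a > 0\<close> by simp
    have "emeasure lborel (cbox ?l ?u) = ennreal (\<Prod>i\<in>Basis. (?u - ?l) \<bullet> i)"
    proof (rule emeasure_lborel_cbox)
      fix i :: 'a assume "i \<in> Basis"
      then show "?l \<bullet> i \<le> ?u \<bullet> i" using eq[of i] pos \<open>R > 0\<close> by (auto simp: inner_simps split: if_splits)
    qed
    also have "(\<Prod>i\<in>Basis. (?u - ?l) \<bullet> i) = (\<Prod>i\<in>Basis. if i = b then 2 * R + real N * a else 2 * R)"
      by (intro prod.cong refl eq)
    also have "\<dots> = (2 * R + real N * a) * (2 * R) ^ (DIM('a) - 1)"
      using b by (subst prod.remove[of _ b]) (auto simp: card_Diff_singleton)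
    finally show ?thesis .
  qed
  also have "\<dots> \<le> ennreal (real N * (2 * a * (2 * R) ^ (DIM('a) - 1)))"
  proof (rule ennreal_leI)
    have "(2 * R + real N * a) * (2 * R) ^ (DIM('a) - 1) \<le> (2 * (real N * a)) * (2 * R) ^ (DIM('a) - 1)"
      using N \<open>R > 0\<close> by (intro mult_right_mono zero_le_power) linarith+
    then show "(2 * R + real N * a) * (2 * R) ^ (DIM('a) - 1) \<le> real N * (2 * a * (2 * R) ^ (DIM('a) - 1))"
      by (simp add: ac_simps)
  qed
  finally have le: "ennreal (real N) * emeasure lborel S \<le> ennreal (real N) * ennreal (2 * a * (2 * R) ^ (DIM('a) - 1))"
    using assms by (simp add: T ennreal_of_nat_eq_real_of_nat ennreal_mult)
  show ?thesis
    using le \<open>N > 0\<close> by (subst (asm) ennreal_mult_le_mult_iff) auto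
qed

text \<open>The point is a convex combination with weight 1/m. Read contrapositively: a line that
  has left \<Omega> after one step of length a does not return after m steps.\<close>

lemma convex_add_multiple_mem:
  assumes "convex \<Omega>" "x \<in> \<Omega>" "x + (real m * a) *\<^sub>R b \<in> \<Omega>" "(m::nat) \<ge> 1"
  shows "x + a *\<^sub>R b \<in> \<Omega>"
proof -
  let ?t = "1 / real m"
  have "(1 - ?t) *\<^sub>R x + ?t *\<^sub>R (x + (real m * a) *\<^sub>R b) \<in> \<Omega>"
    using assms by (intro convexD_alt) auto
  moreover have "(1 - ?t) *\<^sub>R x + ?t *\<^sub>R (x + (real m * a) *\<^sub>R b) = x + a *\<^sub>R b"
    using assms(4) by (simp add: scaleR_add_right scaleR_diff_left)
  ultimately show ?thesis by simp
qed

text \<open>A point of the layer leaves \<Omega> by a step n s along some \<plusminus>b, so 2 n sets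
  \<open>P b\<close> and \<open>Q b\<close> cover the layer. Convexity makes each disjoint from its
  translates by multiples of the step, whence each has measure at most 2 n s (2 R)^(n-1).\<close>

lemma emeasure_convex_boundary_layer_le:
  fixes \<Omega> :: "'a::euclidean_space set"
  assumes "convex \<Omega>" "open \<Omega>" "frontier \<Omega> \<noteq> {}" and "R > 0" "s > 0"
  shows "emeasure lborel {x \<in> \<Omega> \<inter> cball z R. infdist x (frontier \<Omega>) < s}
    \<le> ennreal (4 * real DIM('a) ^ 2 * (2 * R) ^ (DIM('a) - 1) * s)"
proof -
  have [measurable]: "\<Omega> \<in> sets borel" using assms by simp
  let ?a = "real DIM('a) * s"
  let ?B = "2 * ?a * (2 * R) ^ (DIM('a) - 1)"
  define P where "P b = {x \<in> \<Omega> \<inter> cball z R. x + ?a *\<^sub>R b \<notin> \<Omega>}" for b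
  define Q where "Q b = {x \<in> \<Omega> \<inter> cball z R. x - ?a *\<^sub>R b \<notin> \<Omega>}" for b
  have [measurable]: "P b \<in> sets borel" "Q b \<in> sets borel" for b
    unfolding P_def Q_def by measurable
  have a: "?a > 0" using assms by simp
  have P: "emeasure lborel (P b) \<le> ennreal ?B" if b: "b \<in> Basis" for b
  proof (rule emeasure_disjoint_translates_le[OF _ _ b a \<open>R > 0\<close>])
    fix x and m :: nat assume "x \<in> P b" "m \<ge> 1"
    then show "x + (real m * ?a) *\<^sub>R b \<notin> P b"
      using convex_add_multiple_mem[OF \<open>convex \<Omega>\<close>, of x m ?a b] by (auto simp: P_def)
  qed (auto simp: P_def)
  have Q: "emeasure lborel (Q b) \<le> ennreal ?B" if b: "b \<in> Basis" for b
  proof (rule emeasure_disjoint_translates_le[OF _ _ b a \<open>R > 0\<close>])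
    fix x and m :: nat assume "x \<in> Q b" "m \<ge> 1"
    \<comment> \<open>The translation still goes along +b; convexity is applied backwards, from the
      translated point to x with step -n s.\<close>
    then show "x + (real m * ?a) *\<^sub>R b \<notin> Q b"
      using convex_add_multiple_mem[OF \<open>convex \<Omega>\<close>, of "x + (real m * ?a) *\<^sub>R b" m "- ?a" b]
      by (auto simp: Q_def)
  qed (auto simp: Q_def)
  have "emeasure lborel {x \<in> \<Omega> \<inter> cball z R. infdist x (frontier \<Omega>) < s}
      \<le> emeasure lborel (\<Union>b\<in>Basis. P b \<union> Q b)"
    using frontier_close_imp_basis_exit[OF assms(1,2) _ assms(3), where s = s]
    by (intro emeasure_mono) (auto simp: P_def Q_def)
  also have "\<dots> \<le> (\<Sum>b\<in>Basis. emeasure lborel (P b \<union> Q b))"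
    by (intro emeasure_subadditive_finite) auto
  also have "\<dots> \<le> (\<Sum>b\<in>(Basis::'a set). ennreal (2 * ?B))"
  proof (rule sum_mono)
    fix b :: 'a assume b: "b \<in> Basis"
    have "emeasure lborel (P b \<union> Q b) \<le> emeasure lborel (P b) + emeasure lborel (Q b)"
      by (intro emeasure_subadditive) auto
    also have "\<dots> \<le> ennreal ?B + ennreal ?B" using P[OF b] Q[OF b] by (rule add_mono)
    also have "\<dots> = ennreal (2 * ?B)"
      by (subst mult_2, rule ennreal_plus[symmetric]) (use \<open>s > 0\<close> \<open>R > 0\<close> in simp_all)
    finally show "emeasure lborel (P b \<union> Q b) \<le> ennreal (2 * ?B)" .
  qed
  also have "\<dots> = ennreal (4 * real DIM('a) ^ 2 * (2 * R) ^ (DIM('a) - 1) * s)"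
  proof -
    have "(\<Sum>b\<in>(Basis::'a set). ennreal (2 * ?B)) = ennreal (real DIM('a) * (2 * ?B))"
      by (simp only: sum_constant ennreal_of_nat_eq_real_of_nat ennreal_mult' of_nat_0_le_iff)
    also have "real DIM('a) * (2 * ?B) = 4 * real DIM('a) ^ 2 * (2 * R) ^ (DIM('a) - 1) * s"
      by (simp add: power2_eq_square)
    finally show ?thesis .
  qed
  finally show ?thesis .
qed

text \<open>On the shell where g lies between d/2^k and 2 d/2^k, the integrand is at most
  (d/2^k)^(-\<delta>) and the mass at most 2 B d/2^k. The products form a geometric series of ratio
  2^(\<delta>-1), which is below 1 because \<delta> < 1.\<close>

lemma nn_integral_powr_le_of_layers:
  fixes g :: "'a \<Rightarrow> real"
  assumes [measurable]: "g \<in> borel_measurable M" "Q \<in> sets M"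
    and pos: "\<And>x. x \<in> Q \<Longrightarrow> 0 < g x" and less: "\<And>x. x \<in> Q \<Longrightarrow> g x < 2 * d"
    and layer: "\<And>s. s > 0 \<Longrightarrow> emeasure M {x \<in> Q. g x < s} \<le> ennreal (B * s)"
    and "d > 0" "B \<ge> 0" "0 < \<delta>" "\<delta> < 1"
  shows "(\<integral>\<^sup>+x\<in>Q. ennreal (g x powr (- \<delta>)) \<partial>M)
    \<le> ennreal (2 * B * d powr (1 - \<delta>) / (1 - 2 powr (\<delta> - 1)))"
proof -
  define q where "q = (2::real) powr (\<delta> - 1)"
  have q: "0 < q" "q < 1"
    using \<open>\<delta> < 1\<close> by (auto simp: q_def intro: powr_less_one)
  have [measurable]: "{x \<in> Q. g x < s} \<in> sets M" for s
  proof -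
    have "{x \<in> Q. g x < s} = Q \<inter> {x \<in> space M. g x < s}"
      using sets.sets_into_space[OF assms(2)] by auto
    then show ?thesis by simp
  qed
  \<comment> \<open>dyadic decomposition of \<open>Q\<close> according to the size of \<open>g\<close>\<close>
  define f where "f k x = ennreal ((d / 2 ^ k) powr (- \<delta>)) * indicator {x \<in> Q. g x < 2 * (d / 2 ^ k)} x" for k :: nat and x
  have [measurable]: "f k \<in> borel_measurable M" for k unfolding f_def by measurable
  have "ennreal (g x powr (- \<delta>)) * indicator Q x \<le> (\<Sum>k. f k x)" for x
  proof (cases "x \<in> Q")
    case True
    have "\<exists>k. d / 2 ^ k \<le> g x"
    proof -
      obtain k where "(1/2) ^ k < g x / d"
        using real_arch_pow_inv[of "g x / d" "1/2"] pos[OF True] \<open>d > 0\<close> by auto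
      then show ?thesis
        using \<open>d > 0\<close> by (intro exI[of _ k]) (simp add: field_simps power_one_over)
    qed
    \<comment> \<open>Minimality of k gives the upper bound g x < 2 d/2^k. For k = 0 that bound is
      the hypothesis g x < 2 d.\<close>
    define k where "k = (LEAST k. d / 2 ^ k \<le> g x)"
    have k: "d / 2 ^ k \<le> g x"
      unfolding k_def using \<open>\<exists>k. d / 2 ^ k \<le> g x\<close> by (rule LeastI_ex)
    have "g x < 2 * (d / 2 ^ k)"
    proof (cases k)
      case 0 then show ?thesis using less[OF True] by simp
    next
      case (Suc j)
      then have "\<not> d / 2 ^ j \<le> g x" using not_less_Least[of j "\<lambda>k. d / 2 ^ k \<le> g x"] by (simp add: k_def)
      then show ?thesis using Suc by simp
    qed
    then have "f k x = ennreal ((d / 2 ^ k) powr (- \<delta>))" using True by (simp add: f_def)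
    moreover have "g x powr (- \<delta>) \<le> (d / 2 ^ k) powr (- \<delta>)"
      using k \<open>d > 0\<close> \<open>0 < \<delta>\<close> by (intro powr_mono2') auto
    moreover have "f k x \<le> (\<Sum>k. f k x)"
      using sum_le_suminf[of "\<lambda>k. f k x" "{k}"] by simp
    ultimately show ?thesis using True by (auto intro: order_trans ennreal_leI)
  qed simp
  then have "(\<integral>\<^sup>+x\<in>Q. ennreal (g x powr (- \<delta>)) \<partial>M) \<le> (\<integral>\<^sup>+x. (\<Sum>k. f k x) \<partial>M)"
    by (rule nn_integral_mono)
  also have "\<dots> = (\<Sum>k. \<integral>\<^sup>+x. f k x \<partial>M)"
    by (rule nn_integral_suminf) simp
  also have "\<dots> \<le> (\<Sum>k. ennreal (2 * B * d powr (1 - \<delta>) * q ^ k))"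
  proof (rule suminf_le)
    fix k :: nat
    let ?e = "d / 2 ^ k"
    have e: "?e > 0" using \<open>d > 0\<close> by simp
    have "(\<integral>\<^sup>+x. f k x \<partial>M) = ennreal (?e powr (- \<delta>)) * emeasure M {x \<in> Q. g x < 2 * ?e}"
      unfolding f_def by (rule nn_integral_cmult_indicator) simp
    also have "\<dots> \<le> ennreal (?e powr (- \<delta>)) * ennreal (B * (2 * ?e))"
      using layer[of "2 * ?e"] e by (intro mult_left_mono) auto
    also have "\<dots> = ennreal (?e powr (- \<delta>) * (B * (2 * ?e)))"
      by (rule ennreal_mult'[symmetric]) simp
    also have "?e powr (- \<delta>) * (B * (2 * ?e)) = 2 * B * ?e powr (1 - \<delta>)"
    proof -
      have "?e powr (1 - \<delta>) = ?e powr (- \<delta>) * ?e"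
        using e powr_add[of ?e "- \<delta>" 1] by (simp only: powr_one uminus_add_conv_diff less_imp_le)
      then show ?thesis by (simp only: ac_simps)
    qed
    also have "?e powr (1 - \<delta>) = d powr (1 - \<delta>) * q ^ k"
    proof -
      have "?e powr (1 - \<delta>) = d powr (1 - \<delta>) / (2 powr real k) powr (1 - \<delta>)"
        using \<open>d > 0\<close> by (simp add: powr_divide powr_realpow)
      also have "\<dots> = d powr (1 - \<delta>) * 2 powr ((\<delta> - 1) * real k)"
        by (simp add: powr_powr powr_minus_divide[symmetric] divide_powr_uminus algebra_simps)
      also have "2 powr ((\<delta> - 1) * real k) = q ^ k"
        unfolding q_def by (simp add: powr_powr[symmetric] powr_realpow)
      finally show ?thesis .
    qed
    finally show "(\<integral>\<^sup>+x. f k x \<partial>M) \<le> ennreal (2 * B * d powr (1 - \<delta>) * q ^ k)"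
      by (simp add: ac_simps)
  qed auto
  also have "\<dots> = ennreal (2 * B * d powr (1 - \<delta>) / (1 - q))"
  proof -
    have "(\<lambda>k. 2 * B * d powr (1 - \<delta>) * q ^ k) sums (2 * B * d powr (1 - \<delta>) * (1 / (1 - q)))"
      using q by (intro sums_mult geometric_sums) auto
    then show ?thesis
      using q \<open>B \<ge> 0\<close> by (subst suminf_ennreal2) (auto simp: sums_iff)
  qed
  finally show ?thesis by (simp add: q_def)
qed

section \<open>Tubes of slopes and the geometry at a touching ball\<close>

definition tube :: "'a::real_normed_vector \<Rightarrow> 'a \<Rightarrow> real \<Rightarrow> 'a set" where
  "tube p \<nu> r = (\<Union>t\<in>{1/2..1}. ball (p + t *\<^sub>R \<nu>) r)"

lemma open_tube: "open (tube p \<nu> r)"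
  unfolding tube_def by blast

text \<open>The tube contains N disjoint balls of radius r, with centres spaced 2 r apart along the
  segment. The choice N = ceiling of 1/(4 r) keeps the centres within the segment of length 1/2, and
  N r \<ge> 1/4 gives the bound.\<close>

lemma emeasure_tube_ge:
  fixes p \<nu> :: "'a::euclidean_space"
  assumes "norm \<nu> = 1" "r > 0"
  shows "ennreal (unit_ball_vol (real DIM('a)) * r ^ (DIM('a) - 1) / 4) \<le> emeasure lborel (tube p \<nu> r)"
proof -
  define N where "N = nat \<lceil>1 / (4 * r)\<rceil>"
  define c where "c k = p + (1 / 2 + 2 * r * real k) *\<^sub>R \<nu>" for k :: nat
  have "disjoint_family_on (\<lambda>k. ball (c k) r) {..<N}"
    unfolding disjoint_family_on_def
  proof (intro ballI impI)
    fix k m :: nat assume "k \<noteq> m"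
    then have "\<bar>real k - real m\<bar> \<ge> 1" by linarith
    moreover have "c k - c m = (2 * r * (real k - real m)) *\<^sub>R \<nu>"
      by (simp add: c_def algebra_simps)
    ultimately have "2 * r \<le> dist (c k) (c m)"
      using assms by (simp add: dist_norm abs_mult)
    then show "ball (c k) r \<inter> ball (c m) r = {}"
      by (intro disjoint_ballI) simp
  qed
  then have "emeasure lborel (\<Union>k<N. ball (c k) r) = (\<Sum>k<N. emeasure lborel (ball (c k) r))"
    by (intro sum_emeasure[symmetric]) auto
  also have "\<dots> = ennreal (real N * (unit_ball_vol (real DIM('a)) * r ^ DIM('a)))"
    using assms by (simp add: emeasure_ball ennreal_of_nat_eq_real_of_nat ennreal_mult)
  finally have eq: "emeasure lborel (\<Union>k<N. ball (c k) r) = \<dots>" .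
  have "(\<Union>k<N. ball (c k) r) \<subseteq> tube p \<nu> r"
  proof -
    have "1 / 2 + 2 * r * real k \<in> {1/2..1}" if "k < N" for k
    proof -
      have "real k < 1 / (4 * r)" using that assms by (simp add: N_def less_ceiling_iff zless_nat_eq_int_zless)
      then show ?thesis using assms by (simp add: field_simps)
    qed
    then show ?thesis unfolding tube_def c_def by fastforce
  qed
  then have "emeasure lborel (\<Union>k<N. ball (c k) r) \<le> emeasure lborel (tube p \<nu> r)"
    by (intro emeasure_mono) (auto simp: open_tube)
  moreover have "unit_ball_vol (real DIM('a)) * r ^ (DIM('a) - 1) / 4
      \<le> real N * (unit_ball_vol (real DIM('a)) * r ^ DIM('a))"
  proof -
    have "1 / 4 \<le> real N * r"
      using mult_right_mono[OF real_nat_ceiling_ge[of "1 / (4 * r)"], of r] assms by (simp add: N_def)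
    then have "1 / 4 * (unit_ball_vol (real DIM('a)) * r ^ (DIM('a) - 1))
        \<le> real N * r * (unit_ball_vol (real DIM('a)) * r ^ (DIM('a) - 1))"
      using assms by (intro mult_right_mono) auto
    moreover have "r ^ DIM('a) = r * r ^ (DIM('a) - 1)"
      by (simp flip: power_Suc)
    ultimately show ?thesis by (simp add: ac_simps)
  qed
  ultimately show ?thesis
    unfolding eq by (meson ennreal_leI order_trans)
qed

text \<open>The inclusion gives |x - a| + d \<le> r, and the triangle inequality through z gives the
  reverse. Equality in the triangle inequality makes x - a and z - x parallel.\<close>

lemma touching_balls_collinear:
  fixes a x z :: "'a::euclidean_space"
  assumes "ball x d \<subseteq> cball a r" "dist x z = d" "dist a z = r" "d > 0"
  shows "d *\<^sub>R (z - a) = r *\<^sub>R (z - x)"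
proof -
  have "cball x d \<subseteq> cball a r"
    using closure_mono[OF assms(1)] \<open>d > 0\<close> by simp
  then have "norm (x - a) + d \<le> r"
    using \<open>d > 0\<close> by (auto simp: cball_subset_cball_iff dist_norm)
  moreover have za: "z - a = (x - a) + (z - x)" by simp
  have d: "norm (z - x) = d" and r: "norm (z - a) = r"
    using assms by (auto simp: dist_norm norm_minus_commute)
  moreover have "norm (z - a) \<le> norm (x - a) + norm (z - x)"
    unfolding za by (rule norm_triangle_ineq)
  ultimately have eq: "norm (x - a) + d = r" by simp
  then have "norm ((x - a) + (z - x)) = norm (x - a) + norm (z - x)"
    using d r by simp
  then have "norm (x - a) *\<^sub>R (z - x) = norm (z - x) *\<^sub>R (x - a)"
    by (simp only: norm_triangle_eq)
  then have "d *\<^sub>R (x - a) = (r - d) *\<^sub>R (z - x)" using d eq[symmetric] by simp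
  moreover have "d *\<^sub>R (z - a) = d *\<^sub>R (x - a) + d *\<^sub>R (z - x)"
    by (simp flip: scaleR_add_right)
  ultimately show ?thesis by (simp flip: scaleR_add_left)
qed

text \<open>Let h be the depth of x below the tangent plane at z. The enclosing ball gives |z - x|^2
  \<le> 2 R0 h. Since q is close to t \<nu>, the sign of q \<bullet> (x - x0) gives h \<le> d plus
  an error controlled by |z - x|. Together they force h < 2 d, and then |z - x|^2 \<le> 4 R0
  d.\<close>

lemma cap_bounds:
  fixes a x x0 z \<nu> q :: "'a::euclidean_space"
  assumes "norm \<nu> = 1" and z: "z = a + r *\<^sub>R \<nu>" and x0: "x0 = z - d *\<^sub>R \<nu>" and x: "x \<in> cball a r"
    and "0 < r" "r \<le> R0" "0 < d" "d \<le> 1 / 4"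
    and t: "t > 0" and q: "norm (q - t *\<^sub>R \<nu>) \<le> t * (sqrt d / (4 * (1 + sqrt R0)))"
    and mono: "0 \<le> q \<bullet> (x - x0)"
  shows "(z - x) \<bullet> \<nu> < 2 * d" "dist z x \<le> 2 * sqrt R0 * sqrt d"
proof -
  define h where "h = (z - x) \<bullet> \<nu>"
  \<comment> \<open>This is the relative aperture of the tube, small enough that the error term
    below is at most h/4.\<close>
  define \<epsilon> where "\<epsilon> = 1 / (4 * (1 + sqrt R0))"
  have R0: "R0 > 0" using assms by linarith
  have \<nu>: "\<nu> \<bullet> \<nu> = 1" using \<open>norm \<nu> = 1\<close> by (simp add: norm_eq_1)
  have \<epsilon>: "\<epsilon> > 0" "\<epsilon> * (sqrt R0 + 1/4) \<le> 1/4"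
  proof -
    have "sqrt R0 > 0" using R0 by simp
    then show "\<epsilon> > 0" "\<epsilon> * (sqrt R0 + 1/4) \<le> 1/4"
      unfolding \<epsilon>_def by (auto simp: divide_le_eq not_less intro!: divide_pos_pos add_pos_pos add_nonneg_nonneg)
  qed
  have "norm (x - a) ^ 2 \<le> r ^ 2"
    using x by (intro power_mono) (auto simp: dist_norm norm_minus_commute)
  moreover have "x - a = r *\<^sub>R \<nu> - (z - x)" using z by simp
  moreover have "norm (r *\<^sub>R \<nu> - y) ^ 2 = r ^ 2 - 2 * r * (y \<bullet> \<nu>) + norm y ^ 2" for y
    unfolding power2_norm_eq_inner
    by (simp add: inner_diff_left inner_diff_right \<nu> inner_commute[of \<nu> y] power2_eq_square algebra_simps)
  ultimately have zx: "norm (z - x) ^ 2 \<le> 2 * r * h"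
    by (simp only: h_def)
  then have h0: "h \<ge> 0"
    using \<open>r > 0\<close> by (metis mult_pos_pos zero_le_mult_iff zero_less_numeral order_trans zero_le_power2 not_less)
  then have zx2: "norm (z - x) ^ 2 \<le> 2 * R0 * h"
    using zx mult_right_mono[OF \<open>r \<le> R0\<close> h0] by linarith
  have qx: "q \<bullet> (x - x0) = t * (d - h) + (q - t *\<^sub>R \<nu>) \<bullet> (x - x0)"
    using \<nu> by (simp add: x0 h_def inner_diff_left inner_diff_right inner_commute algebra_simps)
  have "(q - t *\<^sub>R \<nu>) \<bullet> (x - x0) \<le> norm (q - t *\<^sub>R \<nu>) * norm (x - x0)"
    by (rule norm_cauchy_schwarz)
  also have "\<dots> \<le> (t * (\<epsilon> * sqrt d)) * (norm (z - x) + d)"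
  proof (rule mult_mono)
    have xx0: "x - x0 = d *\<^sub>R \<nu> - (z - x)" using x0 by simp
    show "norm (x - x0) \<le> norm (z - x) + d"
      unfolding xx0 using norm_triangle_ineq4[of "d *\<^sub>R \<nu>" "z - x"] \<open>d > 0\<close> \<open>norm \<nu> = 1\<close> by simp
  qed (use q t \<epsilon> \<open>d > 0\<close> in \<open>auto simp: \<epsilon>_def\<close>)
  finally have "0 \<le> t * (d - h + \<epsilon> * sqrt d * (norm (z - x) + d))"
    using mono qx by (simp add: algebra_simps)
  then have hle: "h \<le> d + \<epsilon> * sqrt d * (norm (z - x) + d)"
    using t by (simp add: zero_le_mult_iff)
  have "h < 2 * d"
  proof (rule ccontr)
    assume "\<not> h < 2 * d"
    then have h: "2 * d \<le> h" "h > 0" using \<open>d > 0\<close> by auto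
    have "(sqrt d * norm (z - x)) ^ 2 \<le> (h * sqrt R0) ^ 2"
    proof -
      have "d * norm (z - x) ^ 2 \<le> (h / 2) * (2 * R0 * h)"
        using zx2 h \<open>d > 0\<close> by (intro mult_mono) auto
      also have "(h / 2) * (2 * R0 * h) = h ^ 2 * R0" by (simp add: power2_eq_square)
      finally show ?thesis using \<open>d > 0\<close> R0 by (simp add: power_mult_distrib)
    qed
    then have 1: "sqrt d * norm (z - x) \<le> h * sqrt R0"
      by (rule power2_le_imp_le) (use h R0 in simp)
    \<comment> \<open>Here d \<le> 1/4 enters: with d \<le> h/2 it bounds sqrt d * d by h/4.\<close>
    have "sqrt d \<le> sqrt ((1/2)\<^sup>2)"
      using \<open>d \<le> 1 / 4\<close> by (intro real_sqrt_le_mono) (simp add: power2_eq_square)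
    then have "sqrt d \<le> 1 / 2" by simp
    then have 2: "sqrt d * d \<le> 1 / 2 * (h / 2)"
      using h \<open>d > 0\<close> by (intro mult_mono) auto
    have "\<epsilon> * (sqrt d * norm (z - x) + sqrt d * d) \<le> \<epsilon> * (h * sqrt R0 + 1 / 2 * (h / 2))"
      using 1 2 \<epsilon> by (intro mult_left_mono add_mono) auto
    also have "\<dots> = h * (\<epsilon> * (sqrt R0 + 1/4))" by (simp add: algebra_simps)
    also have "\<dots> \<le> h * (1/4)" using \<epsilon> h by (intro mult_left_mono) auto
    \<comment> \<open>Since d \<le> h/2, the bound \<open>hle\<close> would give h \<le> h/2 + h/4
      with h > 0.\<close>
    finally show False using hle h by (simp add: algebra_simps)
  qed
  then show "(z - x) \<bullet> \<nu> < 2 * d" by (simp add: h_def)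
  have "2 * R0 * h \<le> 2 * R0 * (2 * d)" using \<open>h < 2 * d\<close> R0 by (intro mult_left_mono) auto
  also have "\<dots> = (2 * sqrt R0 * sqrt d) ^ 2"
    using R0 \<open>d > 0\<close> by (simp add: power_mult_distrib)
  finally have "norm (z - x) ^ 2 \<le> (2 * sqrt R0 * sqrt d) ^ 2"
    using zx2 by linarith
  then have "norm (z - x) \<le> 2 * sqrt R0 * sqrt d"
    by (rule power2_le_imp_le) (use R0 \<open>d > 0\<close> in simp)
  then show "dist z x \<le> 2 * sqrt R0 * sqrt d" by (simp add: dist_norm)
qed

section \<open>Comparison of masses\<close>

text \<open>\<open>cost\<close> is linear in its first argument, so u is a supremum of affine
  functions.\<close>

lemma c_convex_on_imp_convex_on:
  assumes "c_convex_on \<Omega> u" "convex \<Omega>"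
  shows "convex_on \<Omega> u"
proof -
  obtain \<A> where ne: "\<A> \<noteq> {}" and sup: "\<forall>x\<in>\<Omega>. bdd_above ((\<lambda>(yb, l). - cost x yb + l) ` \<A>) \<and>
      u x = (SUP (yb, l)\<in>\<A>. - cost x yb + l)"
    using assms(1) unfolding c_convex_on_def by (elim exE conjE) (rule that)
  then have bdd: "\<And>x. x \<in> \<Omega> \<Longrightarrow> bdd_above ((\<lambda>(yb, l). - cost x yb + l) ` \<A>)"
    and u: "\<And>x. x \<in> \<Omega> \<Longrightarrow> u x = (SUP (yb, l)\<in>\<A>. - cost x yb + l)"
    by simp_all
  have le: "- cost x yb + l \<le> u x" if "x \<in> \<Omega>" "(yb, l) \<in> \<A>" for x yb l
    using cSUP_upper[OF that(2) bdd[OF that(1)]] u[OF that(1)] by simp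
  show ?thesis
    unfolding convex_on_def
  proof (intro conjI ballI allI impI assms(2))
    fix x y and a b :: real
    assume xy: "x \<in> \<Omega>" "y \<in> \<Omega>" and ab: "0 \<le> a" "0 \<le> b" "a + b = 1"
    then have "a *\<^sub>R x + b *\<^sub>R y \<in> \<Omega>" using assms(2) by (simp add: convexD)
    then have "u (a *\<^sub>R x + b *\<^sub>R y) = (SUP (yb, l)\<in>\<A>. - cost (a *\<^sub>R x + b *\<^sub>R y) yb + l)" by (rule u)
    also have "\<dots> \<le> a * u x + b * u y"
    proof (rule cSUP_least[OF ne], clarify)
      fix yb l assume "(yb, l) \<in> \<A>"
      then have "a * (- cost x yb + l) + b * (- cost y yb + l) \<le> a * u x + b * u y"
        using le xy ab by (intro add_mono mult_left_mono) auto
      moreover have "- cost (a *\<^sub>R x + b *\<^sub>R y) yb + (a + b) * l = a * (- cost x yb + l) + b * (- cost y yb + l)"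
        by (simp add: cost_def inner_add_left algebra_simps)
      ultimately show "- cost (a *\<^sub>R x + b *\<^sub>R y) yb + l \<le> a * u x + b * u y" using ab by simp
    qed
    finally show "u (a *\<^sub>R x + b *\<^sub>R y) \<le> a * u x + b * u y" .
  qed
qed

text \<open>On the line through x and y, this is the tangent inequality for a convex function of one
  real variable.\<close>

lemma convex_on_gradient_in_subdiff:
  fixes u :: "real^'n::finite \<Rightarrow> real"
  assumes "convex_on \<Omega> u" "open \<Omega>" "x \<in> \<Omega>" and der: "(u has_derivative (\<lambda>h. p \<bullet> h)) (at x)"
  shows "p \<in> subdiff \<Omega> u x"
  unfolding subdiff_def
proof (intro CollectI ballI)
  fix y assume y: "y \<in> \<Omega>"
  let ?l = "\<lambda>t::real. x + t *\<^sub>R (y - x)"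
  have conv: "convex \<Omega>" using assms(1) by (simp add: convex_on_def)
  define A where "A = ?l -` \<Omega>"
  have A: "open A" unfolding A_def by (intro open_vimage assms continuous_intros)
  have l: "?l (a * s + b * t) = a *\<^sub>R ?l s + b *\<^sub>R ?l t" if "a + b = 1" for a b s t
  proof -
    have "a *\<^sub>R x + b *\<^sub>R x = x" using that by (simp flip: scaleR_add_left)
    then show ?thesis by (simp add: algebra_simps)
  qed
  have cA: "convex A"
    unfolding convex_def A_def using conv l by (auto simp: convex_def)
  have "convex_on A (u \<circ> ?l)"
    unfolding convex_on_def
  proof (intro conjI cA ballI allI impI)
    fix s t a b :: real assume "s \<in> A" "t \<in> A" "0 \<le> a" "0 \<le> b" "a + b = 1"
    then have "u (a *\<^sub>R ?l s + b *\<^sub>R ?l t) \<le> a * u (?l s) + b * u (?l t)"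
      using assms(1) unfolding convex_on_def A_def by blast
    then show "(u \<circ> ?l) (a *\<^sub>R s + b *\<^sub>R t) \<le> a * (u \<circ> ?l) s + b * (u \<circ> ?l) t"
      using l[OF \<open>a + b = 1\<close>, of s t] by simp
  qed
  moreover have "connected A" using cA by (rule convex_connected)
  moreover have "0 \<in> interior A" "1 \<in> A"
    using A assms(3) y by (auto simp: interior_open A_def)
  moreover have "((u \<circ> ?l) has_field_derivative p \<bullet> (y - x)) (at 0 within A)"
  proof -
    have "(?l has_derivative (\<lambda>t. t *\<^sub>R (y - x))) (at 0)"
      by (auto intro!: derivative_eq_intros)
    moreover have "(u has_derivative (\<lambda>h. p \<bullet> h)) (at (?l 0))" using der by simp
    ultimately have "((u \<circ> ?l) has_derivative ((\<lambda>h. p \<bullet> h) \<circ> (\<lambda>t. t *\<^sub>R (y - x)))) (at 0)"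
      by (rule diff_chain_at)
    moreover have "(\<lambda>h. p \<bullet> h) \<circ> (\<lambda>t. t *\<^sub>R (y - x)) = (*) (p \<bullet> (y - x))"
      by (auto simp: fun_eq_iff)
    ultimately show ?thesis
      by (simp add: has_field_derivative_def has_derivative_at_withinI)
  qed
  ultimately have "(u \<circ> ?l) 1 - (u \<circ> ?l) 0 \<ge> p \<bullet> (y - x) * (1 - 0)"
    by (rule convex_on_imp_above_tangent)
  then show "u x + p \<bullet> (y - x) \<le> u y" by simp
qed

text \<open>At points of non-differentiability \<open>grad\<close> takes the single junk value \<open>SOME p. False\<close>. Removing this
  one slope, a null set, makes it unnecessary to know that \<open>u\<close> is differentiable almost everywhere.\<close>

lemma grad_has_derivative:
  assumes "grad u x \<noteq> (SOME p. False)"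
  shows "(u has_derivative (\<lambda>h. grad u x \<bullet> h)) (at x)"
proof (cases "\<exists>p. (u has_derivative (\<lambda>h. p \<bullet> h)) (at x)")
  case True
  then show ?thesis unfolding grad_def by (rule someI_ex)
next
  case False
  then have "grad u x = (SOME p. False)" by (simp add: grad_def)
  with assms show ?thesis by contradiction
qed

text \<open>The segment from x to y joins \<Omega> to its complement and so meets the
  frontier.\<close>

lemma infdist_frontier_le:
  fixes \<Omega> :: "'a::euclidean_space set"
  assumes "x \<in> \<Omega>" "y \<notin> \<Omega>"
  shows "infdist x (frontier \<Omega>) \<le> dist x y"
proof -
  obtain w where "w \<in> closed_segment x y" "w \<in> frontier \<Omega>"
    using connected_Int_frontier[of "closed_segment x y" \<Omega>] assms by auto
  then show ?thesis
    using infdist_le[of w "frontier \<Omega>" x] dist_in_closed_segment[of w x y] by (simp add: dist_commute)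
qed

text \<open>\<open>G\<close> is enclosed in the Borel set \<open>Q\<close>, the part of the layer of
  width 2 d near z. There K is dominated by a negative power of the distance to the frontier, and
  the linear growth of the layers makes its integral of order d^(1-\<delta>).\<close>

lemma source_mass_le:
  fixes \<Omega> :: "(real^'n::finite) set" and K :: "real^'n \<Rightarrow> real"
  defines "dst \<equiv> \<lambda>x. infdist x (frontier \<Omega>)"
  assumes "convex \<Omega>" "open \<Omega>" "frontier \<Omega> \<noteq> {}" and K: "K \<in> borel_measurable (restrict_space borel \<Omega>)"
    and K_le: "\<And>x. x \<in> \<Omega> \<Longrightarrow> dst x < 2 * d \<Longrightarrow> K x \<le> C0 / dst x powr \<delta>"
    and "R > 0" "d > 0" "C0 > 0" "0 < \<delta>" "\<delta> < 1"
    and G: "G \<subseteq> {x \<in> \<Omega> \<inter> cball z R. dst x < 2 * d}"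
  shows "emeasure (source_measure \<Omega> K) G \<le>
    ennreal (C0 * (2 * (4 * real CARD('n) ^ 2 * (2 * R) ^ (CARD('n) - 1)) * d powr (1 - \<delta>) / (1 - 2 powr (\<delta> - 1))))"
proof -
  define Q where "Q = {x \<in> \<Omega> \<inter> cball z R. dst x < 2 * d}"
  let ?B = "4 * real CARD('n) ^ 2 * (2 * R) ^ (CARD('n) - 1)"
  have \<Omega> [measurable]: "\<Omega> \<in> sets borel" using assms by simp
  have dst [measurable]: "dst \<in> borel_measurable borel"
    unfolding dst_def by (intro borel_measurable_continuous_onI continuous_intros)
  have Q [measurable]: "Q \<in> sets borel"
    unfolding Q_def by measurable
  have pos: "dst x > 0" if "x \<in> \<Omega>" for x
    unfolding dst_def using that assms(3,4)
    by (intro infdist_pos_not_in_closed) (auto simp: frontier_def interior_open)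
  have K': "K \<in> borel_measurable (restrict_space lebesgue \<Omega>)"
  proof -
    have "(\<lambda>x. x) \<in> measurable (restrict_space lebesgue \<Omega>) (restrict_space borel \<Omega>)"
      by (intro measurable_restrict_space3 measurable_completion) auto
    from measurable_compose[OF this K] show ?thesis .
  qed
  have Qpos: "0 < dst x" and Qless: "dst x < 2 * d" if "x \<in> Q" for x
    using that pos by (auto simp: Q_def)
  have Q\<Omega>: "Q \<subseteq> \<Omega>" by (auto simp: Q_def)
  have "Q \<in> sets (restrict_space lebesgue \<Omega>)"
    using Q\<Omega> Q \<Omega> by (subst sets_restrict_space_iff) auto
  then have "emeasure (source_measure \<Omega> K) G \<le> emeasure (source_measure \<Omega> K) Q"
    using G by (intro emeasure_mono) (auto simp: Q_def source_measure_def)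
  also have "\<dots> = (\<integral>\<^sup>+x. ennreal (K x) * indicator Q x \<partial>restrict_space lebesgue \<Omega>)"
    unfolding source_measure_def using K' \<open>Q \<in> sets (restrict_space lebesgue \<Omega>)\<close>
    by (intro emeasure_density) auto
  also have "\<dots> = (\<integral>\<^sup>+x. ennreal (K x) * indicator Q x * indicator \<Omega> x \<partial>lebesgue)"
    by (rule nn_integral_restrict_space) (use \<Omega> in auto)
  also have "\<dots> = (\<integral>\<^sup>+x. ennreal (K x) * indicator Q x * indicator \<Omega> x \<partial>lborel)"
    by (rule nn_integral_completion)
  also have "\<dots> \<le> (\<integral>\<^sup>+x. ennreal C0 * (ennreal (dst x powr (- \<delta>)) * indicator Q x) \<partial>lborel)"
  proof (rule nn_integral_mono)
    fix x
    have "ennreal (K x) \<le> ennreal C0 * ennreal (dst x powr (- \<delta>))" if "x \<in> Q"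
    proof -
      have "K x \<le> C0 * dst x powr (- \<delta>)"
        using K_le[of x] that by (auto simp: Q_def powr_minus_divide)
      then show ?thesis using \<open>C0 > 0\<close> by (simp add: ennreal_mult'[symmetric] ennreal_leI)
    qed
    then show "ennreal (K x) * indicator Q x * indicator \<Omega> x
        \<le> ennreal C0 * (ennreal (dst x powr (- \<delta>)) * indicator Q x)"
      by (auto simp: indicator_def)
  qed
  also have "\<dots> = ennreal C0 * (\<integral>\<^sup>+x. ennreal (dst x powr (- \<delta>)) * indicator Q x \<partial>lborel)"
    by (rule nn_integral_cmult) measurable
  also have "\<dots> \<le> ennreal C0 * ennreal (2 * ?B * d powr (1 - \<delta>) / (1 - 2 powr (\<delta> - 1)))"
  proof (intro mult_left_mono nn_integral_powr_le_of_layers)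
    fix s :: real assume "s > 0"
    have "emeasure lborel {x \<in> Q. dst x < s} \<le> emeasure lborel {x \<in> \<Omega> \<inter> cball z R. infdist x (frontier \<Omega>) < s}"
    proof (rule emeasure_mono)
      have "{x \<in> \<Omega> \<inter> cball z R. dst x < s} \<in> sets borel" by measurable
      then show "{x \<in> \<Omega> \<inter> cball z R. infdist x (frontier \<Omega>) < s} \<in> sets lborel" by (simp add: dst_def)
    qed (auto simp: Q_def dst_def)
    also have "\<dots> \<le> ennreal (?B * s)"
      using emeasure_convex_boundary_layer_le[OF assms(2-4) \<open>R > 0\<close> \<open>s > 0\<close>, of z] by simp
    finally show "emeasure lborel {x \<in> Q. dst x < s} \<le> ennreal (?B * s)" .
  qed (use dst Q Qpos Qless \<open>d > 0\<close> \<open>0 < \<delta>\<close> \<open>\<delta> < 1\<close> \<open>R > 0\<close> in simp_all)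
  also have "\<dots> = ennreal (C0 * (2 * ?B * d powr (1 - \<delta>) / (1 - 2 powr (\<delta> - 1))))"
    using \<open>C0 > 0\<close> by (intro ennreal_mult'[symmetric]) simp
  finally show ?thesis .
qed

text \<open>Every slope in the tube satisfies |p| \<le> |p0| + 2, so hyp p \<le> 1 + |p| \<le> 2
  (|p0| + 2) bounds the density from below. Removing the single slope \<open>c\<close>, later the
  default value of \<open>grad\<close>, leaves the measure unchanged.\<close>

lemma target_mass_tube_ge:
  fixes \<Omega>s :: "'n::finite pt set" and p0 \<nu> c :: "real^'n"
  assumes \<Omega>s: "\<Omega>s \<in> sets sphere_vol" "\<Omega>s \<subseteq> lower_hemisphere"
    and mass: "(\<integral>yb\<in>\<Omega>s. - snd yb \<partial>sphere_vol) = measure lborel (ball (0::real^'n) 1)"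
    and \<nu>: "norm \<nu> = 1" and "0 < r" "r \<le> 1"
  shows "ennreal (1 / (2 * (norm p0 + 2)) ^ (CARD('n) + 2) * (unit_ball_vol (real CARD('n)) * r ^ (CARD('n) - 1) / 4))
    \<le> emeasure (target_measure \<Omega>s) (c_exp ` (tube p0 \<nu> r - {c}))"
proof -
  let ?P = "tube p0 \<nu> r - {c}"
  let ?m = "1 / (2 * (norm p0 + 2)) ^ (CARD('n) + 2)"
  have tube: "tube p0 \<nu> r \<in> sets borel" by (simp add: open_tube)
  then have P: "?P \<in> sets borel" by auto
  have m: "?m \<ge> 0" by simp
  have "ennreal (?m * (unit_ball_vol (real CARD('n)) * r ^ (CARD('n) - 1) / 4))
      = ennreal ?m * ennreal (unit_ball_vol (real CARD('n)) * r ^ (CARD('n) - 1) / 4)"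
    using m by (rule ennreal_mult')
  also have "\<dots> \<le> ennreal ?m * emeasure lborel (tube p0 \<nu> r)"
    using emeasure_tube_ge[OF \<nu> \<open>0 < r\<close>, of p0] by (intro mult_left_mono) auto
  also have "emeasure lborel (tube p0 \<nu> r) = emeasure lborel ?P"
    using tube by (intro emeasure_Diff_null_set[symmetric]) auto
  also have "ennreal ?m * emeasure lborel ?P = (\<integral>\<^sup>+p. ennreal ?m * indicator ?P p \<partial>lborel)"
    using P by (simp add: nn_integral_cmult_indicator)
  also have "\<dots> \<le> (\<integral>\<^sup>+p\<in>?P. ennreal (1 / hyp p ^ (CARD('n) + 2)) \<partial>lborel)"
  proof (rule nn_integral_mono)
    fix p :: "real^'n"
    have "?m \<le> 1 / hyp p ^ (CARD('n) + 2)" if p: "p \<in> ?P"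
    proof -
      obtain t where t: "t \<in> {1/2..1}" "dist (p0 + t *\<^sub>R \<nu>) p < r"
        using p by (auto simp: tube_def)
      have "norm p \<le> norm (p0 + t *\<^sub>R \<nu>) + dist (p0 + t *\<^sub>R \<nu>) p"
        using norm_triangle_sub[of p "p0 + t *\<^sub>R \<nu>"] by (simp add: dist_norm norm_minus_commute)
      also have "norm (p0 + t *\<^sub>R \<nu>) \<le> norm p0 + norm (t *\<^sub>R \<nu>)"
        by (rule norm_triangle_ineq)
      also have "norm (t *\<^sub>R \<nu>) \<le> 1" using t \<nu> by simp
      finally have "norm p \<le> norm p0 + 2" using t \<open>r \<le> 1\<close> by simp
      then have "1 + norm p \<le> 2 * (norm p0 + 2)" using norm_ge_zero[of p0] unfolding distrib_left by linarith
      moreover have "hyp p \<le> 1 + norm p"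
        by (rule real_le_lsqrt) (auto simp: power2_eq_square algebra_simps)
      ultimately have "hyp p ^ (CARD('n) + 2) \<le> (2 * (norm p0 + 2)) ^ (CARD('n) + 2)"
        using hyp_pos[of p] by (intro power_mono) linarith+
      then show ?thesis
        by (rule divide_left_mono) (use hyp_pos[of p] in \<open>auto intro!: mult_pos_pos zero_less_power add_nonneg_pos\<close>)
    qed
    then show "ennreal ?m * indicator ?P p \<le> ennreal (1 / hyp p ^ (CARD('n) + 2)) * indicator ?P p"
      by (auto simp: indicator_def intro!: ennreal_leI)
  qed
  also have "\<dots> = emeasure (target_measure \<Omega>s) (c_exp ` ?P)"
    by (rule emeasure_target_c_exp_image[OF \<Omega>s mass P, symmetric])
  finally show ?thesis .
qed

text \<open>The ball of radius d about x0 lies in \<Omega> and touches the enclosing ball at z, so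
  x0 = z - d \<nu>. Adding the two subgradient inequalities gives (p - p0) \<bullet> (x - x0) \<ge>
  0, and \<open>cap_bounds\<close> applies with q = p - p0.\<close>

lemma large_slopes_near_boundary:
  fixes \<Omega> :: "(real^'n::finite) set" and u :: "real^'n \<Rightarrow> real" and p0 x0 z a :: "real^'n"
  defines "d \<equiv> infdist x0 (frontier \<Omega>)"
  assumes "open \<Omega>" and x0: "x0 \<in> \<Omega>" and p0: "p0 \<in> subdiff \<Omega> u x0"
    and z: "dist x0 z = d" and "0 < d" "d \<le> 1 / 4"
    and ball: "\<Omega> \<subseteq> cball a r" "dist a z = r" "0 < r" "r \<le> R0"
    and x: "x \<in> \<Omega>" and p: "p \<in> subdiff \<Omega> u x"
      "p \<in> tube p0 ((z - a) /\<^sub>R r) (sqrt d / (8 * (1 + sqrt R0)))"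
  shows "infdist x (frontier \<Omega>) < 2 * d" "dist z x \<le> 2 * sqrt R0 * sqrt d"
proof -
  define \<nu> where "\<nu> = (z - a) /\<^sub>R r"
  have \<nu>: "norm \<nu> = 1" and za: "z = a + r *\<^sub>R \<nu>"
    using ball by (auto simp: \<nu>_def dist_norm norm_minus_commute)
  have "ball x0 d \<subseteq> \<Omega>"
    using infdist_frontier_le[OF x0] unfolding d_def by (meson mem_ball not_less subsetI)
  then have "d *\<^sub>R (z - a) = r *\<^sub>R (z - x0)"
    using ball z \<open>0 < d\<close> by (intro touching_balls_collinear) auto
  then have "r *\<^sub>R (d *\<^sub>R \<nu>) = r *\<^sub>R (z - x0)"
    using \<open>0 < r\<close> by (simp add: \<nu>_def field_simps)
  then have "d *\<^sub>R \<nu> = z - x0" using \<open>0 < r\<close> by (simp only: scaleR_cancel_left) simp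
  then have x0z: "x0 = z - d *\<^sub>R \<nu>" by simp
  obtain t where t: "t \<in> {1/2..1}" "dist (p0 + t *\<^sub>R \<nu>) p < sqrt d / (8 * (1 + sqrt R0))"
    using p(2) unfolding tube_def \<nu>_def[symmetric] by auto
  have "0 \<le> (p - p0) \<bullet> (x - x0)"
  proof -
    have "u x + p \<bullet> (x0 - x) \<le> u x0" "u x0 + p0 \<bullet> (x - x0) \<le> u x"
      using p(1) p0 x x0 by (auto simp: subdiff_def)
    then show ?thesis by (simp add: inner_diff_left inner_diff_right)
  qed
  moreover have "norm ((p - p0) - t *\<^sub>R \<nu>) \<le> t * (sqrt d / (4 * (1 + sqrt R0)))"
  proof -
    have "norm ((p - p0) - t *\<^sub>R \<nu>) = dist (p0 + t *\<^sub>R \<nu>) p"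
      by (simp add: dist_norm norm_minus_commute algebra_simps)
    \<comment> \<open>The segment of the tube starts at t = 1/2 so that its fixed radius is small
      relative to the shift t \<nu>; this turns the 8 in the radius into t times the bound with
      4.\<close>
    also have "\<dots> \<le> 1 / 2 * (sqrt d / (4 * (1 + sqrt R0)))" using t by simp
    also have "\<dots> \<le> t * (sqrt d / (4 * (1 + sqrt R0)))"
      using t \<open>0 < d\<close> ball by (intro mult_right_mono divide_nonneg_nonneg) auto
    finally show ?thesis .
  qed
  ultimately have *: "(z - x) \<bullet> \<nu> < 2 * d" "dist z x \<le> 2 * sqrt R0 * sqrt d"
    using cap_bounds[OF \<nu> za x0z, of x R0 t "p - p0"] x ball \<open>0 < d\<close> \<open>d \<le> 1 / 4\<close> t by auto
  show "dist z x \<le> 2 * sqrt R0 * sqrt d" by fact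
  \<comment> \<open>Openness places \<Omega> in the interior of the enclosing ball, hence strictly
    below the tangent plane at z.\<close>
  have below: "(y - a) \<bullet> \<nu> < r" if "y \<in> \<Omega>" for y
  proof -
    have "y \<in> interior (cball a r)"
      using that ball \<open>open \<Omega>\<close> by (meson interior_maximal subsetD)
    then have "norm (y - a) < r" by (simp add: dist_norm norm_minus_commute)
    then show ?thesis using norm_cauchy_schwarz[of "y - a" \<nu>] \<nu> by simp
  qed
  define h where "h = (z - x) \<bullet> \<nu>"
  have \<nu>1: "\<nu> \<bullet> \<nu> = 1" using \<nu> by (simp add: norm_eq_1)
  have "(x + h *\<^sub>R \<nu> - a) \<bullet> \<nu> = r"
    using \<nu>1 by (simp add: h_def za inner_add_left inner_diff_left)
  \<comment> \<open>Moving x by h along \<nu> reaches the tangent plane, which misses \<Omega>; so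
    the depth h bounds the distance from x to the frontier.\<close>
  then have "x + h *\<^sub>R \<nu> \<notin> \<Omega>" using below by fastforce
  then have "infdist x (frontier \<Omega>) \<le> \<bar>h\<bar>"
    using infdist_frontier_le[OF x, of "x + h *\<^sub>R \<nu>"] \<nu> by (simp add: dist_norm)
  moreover have "h > 0"
    using below[OF x] \<nu>1 by (simp add: h_def za inner_add_left inner_diff_left)
  ultimately show "infdist x (frontier \<Omega>) < 2 * d" using *(1) by (simp add: h_def)
qed

text \<open>Both masses contain the cross-section factor X = (sqrt d)^(n-1). It cancels, so that e =
  d^(1-\<delta>) is all that is left of d; M stands for |p0| + 2.\<close>

lemma mass_inequality_imp_power_ge:
  fixes M \<omega> E F X e S C0 N :: real
  assumes "M > 0" "\<omega> > 0" "E > 0" "F > 0" "X > 0" "e > 0" "S > 0" "C0 > 0" "N > 0"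
    and le: "1 / (2 * M) ^ k * (\<omega> * (E * X) / 4) \<le> C0 * (2 * (4 * N * (F * X)) * e / S)"
  shows "\<omega> * E * S / (32 * 2 ^ k * C0 * N * F) * (1 / e) \<le> M ^ k"
proof -
  have "\<omega> * E * X * S \<le> 32 * C0 * N * F * X * e * (2 * M) ^ k"
    using le assms by (simp add: field_simps)
  then have "X * (\<omega> * E * S) \<le> X * (32 * C0 * N * F * e * (2 ^ k * M ^ k))"
    by (simp add: power_mult_distrib ac_simps)
  then have "\<omega> * E * S \<le> 32 * C0 * N * F * e * (2 ^ k * M ^ k)"
    using \<open>X > 0\<close> by simp
  then show ?thesis using assms by (simp add: field_simps)
qed

theorem theorem2p3:
  fixes R0 L \<delta> C0 :: real
  assumes "R0 > 0" and "L > 0" and "0 < \<delta>" and "\<delta> < 1" and "C0 > 0"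
  shows "\<exists>\<Lambda>>0. \<forall>(\<Omega> :: (real^'n::finite) set) (K :: real^'n \<Rightarrow> real) (lam1::real) (lam2::real)
      (\<Omega>s :: 'n pt set) (u :: real^'n \<Rightarrow> real) (r0::real) (\<rho>::real) (x0 :: real^'n) (p0 :: real^'n).
     bounded \<Omega> \<and> convex \<Omega> \<and> open \<Omega> \<and>
     K \<in> borel_measurable (restrict_space borel \<Omega>) \<and>
     closure \<Omega> = closure {x \<in> \<Omega>. K x > 0} \<and>
     0 < lam1 \<and> (\<forall>x\<in>\<Omega>. lam1 \<le> K x \<and> K x \<le> lam2) \<and>
     (\<integral>x\<in>\<Omega>. K x \<partial>lebesgue) = measure lborel (ball (0::real^'n) 1) \<and>
     \<Omega>s \<subseteq> lower_hemisphere \<and> geodesically_convex \<Omega>s \<and> \<Omega>s \<in> sets sphere_vol \<and>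
     (\<integral>x\<in>\<Omega>. K x \<partial>lebesgue) = (\<integral>yb\<in>\<Omega>s. - snd yb \<partial>sphere_vol) \<and>
     brenier_solution \<Omega> K \<Omega>s u \<and>
     r0 > 0 \<and>
     (\<forall>x\<in>\<Omega>. infdist x (frontier \<Omega>) < r0 \<longrightarrow> K x \<le> C0 / infdist x (frontier \<Omega>) powr \<delta>) \<and>
     (\<forall>z\<in>frontier \<Omega>. \<exists>a r. r \<le> R0 \<and> \<Omega> \<subseteq> cball a r \<and> dist a z = r) \<and>
     0 < \<rho> \<and> \<rho> < 1 \<and> (\<exists>C1>1. lipschitz_boundary_consts \<Omega> \<rho> L C1) \<and>
     x0 \<in> \<Omega> \<and> p0 \<in> subdiff \<Omega> u x0 \<and>
     infdist x0 (frontier \<Omega>) \<le> min (\<rho>\<^sup>2 / (16 * (1 + 4 * R0))) (min (r0 / 2) (1 / 4))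
     \<longrightarrow> norm p0 \<ge> \<Lambda> * infdist x0 (frontier \<Omega>) powr (- (1 - \<delta>) / (real CARD('n) + 2)) - 2"
proof -
  let ?n = "CARD('n)"
  define S where "S = 1 - (2::real) powr (\<delta> - 1)"
  have S: "S > 0" using \<open>\<delta> < 1\<close> by (simp add: S_def powr_less_one)
  \<comment> \<open>\<open>E\<close> and \<open>F\<close> are the parts of \<open>rb ^ (n-1)\<close>
    and \<open>(2 * R) ^ (n-1)\<close> that remain after the powers of sqrt d are split off.\<close>
  define E where "E = (1 / (8 * (1 + sqrt R0))) ^ (?n - 1)"
  define F where "F = (4 * sqrt R0) ^ (?n - 1)"
  have sq: "sqrt R0 > 0" using \<open>R0 > 0\<close> by simp
  have EF: "E > 0" "F > 0" using sq by (auto simp: E_def F_def intro!: zero_less_power divide_pos_pos add_pos_pos)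
  define c where "c = unit_ball_vol (real ?n) * E * S / (32 * 2 ^ (?n + 2) * C0 * (real ?n)\<^sup>2 * F)"
  have c: "c > 0" using EF S \<open>C0 > 0\<close> by (simp add: c_def)
  \<comment> \<open>The root undoes the exponent n+2 of the target density. The constant is built
    from \<open>R0\<close>, n, \<delta> and \<open>C0\<close>, before \<Omega>, K and u are
    chosen.\<close>
  define \<Lambda> where "\<Lambda> = c powr (1 / (real ?n + 2))"
  have "\<Lambda> * infdist x0 (frontier \<Omega>) powr (- (1 - \<delta>) / (real CARD('n) + 2)) - 2 \<le> norm p0"
    if conv: "bounded \<Omega>" "convex \<Omega>" "open \<Omega>" and K: "K \<in> borel_measurable (restrict_space borel \<Omega>)"
      and mass: "(\<integral>x\<in>\<Omega>. K x \<partial>lebesgue) = measure lborel (ball (0::real^'n) 1)"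
        "(\<integral>x\<in>\<Omega>. K x \<partial>lebesgue) = (\<integral>yb\<in>\<Omega>s. - snd yb \<partial>sphere_vol)"
      and \<Omega>s: "\<Omega>s \<subseteq> lower_hemisphere" "\<Omega>s \<in> sets sphere_vol"
      and brenier: "brenier_solution \<Omega> K \<Omega>s u"
      and K_le: "\<forall>x\<in>\<Omega>. infdist x (frontier \<Omega>) < r0 \<longrightarrow> K x \<le> C0 / infdist x (frontier \<Omega>) powr \<delta>"
      and balls: "\<forall>z\<in>frontier \<Omega>. \<exists>a r. r \<le> R0 \<and> \<Omega> \<subseteq> cball a r \<and> dist a z = r"
      and x0: "x0 \<in> \<Omega>" "p0 \<in> subdiff \<Omega> u x0"
      and d_le: "infdist x0 (frontier \<Omega>) \<le> r0 / 2" "infdist x0 (frontier \<Omega>) \<le> 1 / 4"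
    for \<Omega> :: "(real^'n) set" and K \<Omega>s u r0 x0 p0
  proof -
    define d where "d = infdist x0 (frontier \<Omega>)"
    have fr: "frontier \<Omega> \<noteq> {}"
      using conv x0 not_bounded_UNIV by (auto simp: frontier_eq_empty)
    obtain z where z: "z \<in> frontier \<Omega>" "d = dist x0 z"
      using infdist_attains_inf[of "frontier \<Omega>" x0] fr by (auto simp: d_def)
    have d: "d > 0"
      unfolding d_def using fr x0 conv
      by (intro infdist_pos_not_in_closed) (auto simp: frontier_def interior_open)
    obtain a r where r: "r \<le> R0" "\<Omega> \<subseteq> cball a r" "dist a z = r"
      using balls z by blast
    \<comment> \<open>For r \<le> 0 the enclosing ball is at most a point, but a nonempty open set
      is infinite.\<close>
    have "r > 0"
    proof (rule ccontr)
      assume "\<not> r > 0"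
      then have "\<Omega> \<subseteq> {a}" using r by (cases "r = 0") auto
      then have "finite \<Omega>" by (rule finite_subset) simp
      then show False using conv x0 finite_imp_not_open by blast
    qed
    define \<nu> where "\<nu> = (z - a) /\<^sub>R r"
    have \<nu>: "norm \<nu> = 1" using r \<open>r > 0\<close> by (simp add: \<nu>_def dist_norm norm_minus_commute)
    define rb where "rb = sqrt d / (8 * (1 + sqrt R0))"
    have rb: "rb > 0" "rb \<le> 1"
    proof -
      have "sqrt d \<le> 1" using d_le(2) by (simp add: d_def)
      moreover have "8 * (1 + sqrt R0) > 8" using sq by simp
      ultimately show "rb > 0" "rb \<le> 1"
        using d unfolding rb_def by (auto simp only: divide_le_eq_1 intro!: divide_pos_pos) (auto simp: real_sqrt_gt_0_iff)
    qed
    define R where "R = 2 * sqrt R0 * sqrt d"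
    have R: "R > 0" using sq d by (simp add: R_def)
    \<comment> \<open>With the default value of \<open>grad\<close> removed, a gradient lying in
      \<open>P\<close> is a genuine derivative.\<close>
    define P where "P = tube p0 \<nu> rb - {SOME p. False}"
    have "P \<in> sets borel" unfolding P_def by (intro sets.Diff borel_open open_tube borel_singleton) auto
    then have P: "c_exp ` P \<in> sets sphere_vol" by (rule c_exp_image_sphere_vol)
    have u: "convex_on \<Omega> u"
      using brenier conv by (auto simp: brenier_solution_def intro: c_convex_on_imp_convex_on)
    define G where "G = T_map u -` (c_exp ` P) \<inter> space (source_measure \<Omega> K)"
    \<comment> \<open>Each x in \<open>G\<close> has a true gradient in the tube. By convexity it is
      a subgradient at x, which confines x to the boundary layer near z.\<close>
    have G: "G \<subseteq> {x \<in> \<Omega> \<inter> cball z R. infdist x (frontier \<Omega>) < 2 * d}"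
    proof
      fix x assume "x \<in> G"
      then have x: "x \<in> \<Omega>" and "T_map u x \<in> c_exp ` P"
        by (auto simp: G_def source_measure_def space_restrict_space)
      then have gP: "grad u x \<in> P"
        unfolding T_map_def by (metis gnomonic_c_exp imageE)
      then have "grad u x \<in> subdiff \<Omega> u x"
        by (intro convex_on_gradient_in_subdiff u conv x grad_has_derivative) (simp add: P_def)
      with gP x show "x \<in> {x \<in> \<Omega> \<inter> cball z R. infdist x (frontier \<Omega>) < 2 * d}"
        using large_slopes_near_boundary[OF conv(3) x0, of z a r R0 x "grad u x"] z(2) d d_le r \<open>r > 0\<close>
        by (auto simp: P_def rb_def R_def \<nu>_def d_def)
    qed
    \<comment> \<open>The push-forward condition equates the target mass of the tube with the source
      mass of \<open>G\<close>; the bounds on the two sides are then compared.\<close>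
    have "emeasure (target_measure \<Omega>s) (c_exp ` P) = emeasure (distr (source_measure \<Omega> K) sphere_vol (T_map u)) (c_exp ` P)"
      using brenier by (simp add: brenier_solution_def)
    also have "\<dots> = emeasure (source_measure \<Omega> K) G"
    proof -
      have "T_map u \<in> measurable (source_measure \<Omega> K) sphere_vol"
        using brenier by (simp add: brenier_solution_def source_measure_def)
      then show ?thesis unfolding G_def using P by (rule emeasure_distr)
    qed
    also have "\<dots> \<le> ennreal (C0 * (2 * (4 * real ?n ^ 2 * (2 * R) ^ (?n - 1)) * d powr (1 - \<delta>) / S))"
      unfolding S_def
    proof (rule source_mass_le[OF conv(2,3) fr K _ R d \<open>C0 > 0\<close> \<open>0 < \<delta>\<close> \<open>\<delta> < 1\<close> G])
      fix x assume "x \<in> \<Omega>" "infdist x (frontier \<Omega>) < 2 * d"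
      then show "K x \<le> C0 / infdist x (frontier \<Omega>) powr \<delta>"
        using K_le d_le(1) by (simp add: d_def)
    qed
    finally have "ennreal (1 / (2 * (norm p0 + 2)) ^ (?n + 2) * (unit_ball_vol (real ?n) * rb ^ (?n - 1) / 4))
        \<le> ennreal (C0 * (2 * (4 * real ?n ^ 2 * (2 * R) ^ (?n - 1)) * d powr (1 - \<delta>) / S))"
      using target_mass_tube_ge[OF \<Omega>s(2,1) _ \<nu> rb, of p0 "SOME p. False"] mass unfolding P_def by simp
    moreover have "rb ^ (?n - 1) = E * sqrt d ^ (?n - 1)"
      by (simp add: rb_def E_def power_divide)
    moreover have "(2 * R) ^ (?n - 1) = F * sqrt d ^ (?n - 1)"
      unfolding R_def F_def by (simp add: power_mult_distrib)
    ultimately have "1 / (2 * (norm p0 + 2)) ^ (?n + 2) * (unit_ball_vol (real ?n) * (E * sqrt d ^ (?n - 1)) / 4)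
        \<le> C0 * (2 * (4 * real ?n ^ 2 * (F * sqrt d ^ (?n - 1))) * d powr (1 - \<delta>) / S)"
      using EF S d \<open>C0 > 0\<close> by (subst (asm) ennreal_le_iff) auto
    then have "unit_ball_vol (real ?n) * E * S / (32 * 2 ^ (?n + 2) * C0 * (real ?n)\<^sup>2 * F) * (1 / d powr (1 - \<delta>))
        \<le> (norm p0 + 2) ^ (?n + 2)"
      by (intro mass_inequality_imp_power_ge[where X = "sqrt d ^ (?n - 1)"])
         (use EF S d \<open>C0 > 0\<close> in \<open>auto intro: add_nonneg_pos\<close>)
    then have main: "c * (1 / d powr (1 - \<delta>)) \<le> (norm p0 + 2) ^ (?n + 2)"
      unfolding c_def .
    \<comment> \<open>The power n+2 undoes the root in \<Lambda> and clears the denominator in the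
      exponent of d, so the claim can be compared with \<open>main\<close>.\<close>
    have "(\<Lambda> * d powr (- (1 - \<delta>) / (real ?n + 2))) ^ (?n + 2) = c * (1 / d powr (1 - \<delta>))"
    proof -
      have pw: "(y powr (e / (real ?n + 2))) ^ (?n + 2) = y powr e" if "y > 0" for y e :: real
      proof -
        have "(y powr (e / (real ?n + 2))) ^ (?n + 2) = (y powr (e / (real ?n + 2))) powr real (?n + 2)"
          using that by (subst powr_realpow) auto
        also have "\<dots> = y powr (e / (real ?n + 2) * real (?n + 2))" by (rule powr_powr)
        also have "e / (real ?n + 2) * real (?n + 2) = e"
          by (simp add: add.commute)
        finally show ?thesis .
      qed
      have "(\<Lambda> * d powr (- (1 - \<delta>) / (real ?n + 2))) ^ (?n + 2) = c powr 1 * d powr (- (1 - \<delta>))"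
        unfolding \<Lambda>_def by (simp only: power_mult_distrib pw[OF c] pw[OF d])
      also have "c powr 1 = c" using c by simp
      also have "d powr (- (1 - \<delta>)) = 1 / d powr (1 - \<delta>)" by (rule powr_minus_divide)
      finally show ?thesis .
    qed
    with main have "(\<Lambda> * d powr (- (1 - \<delta>) / (real ?n + 2))) ^ (?n + 2) \<le> (norm p0 + 2) ^ (?n + 2)"
      by (simp only:)
    then have "\<Lambda> * d powr (- (1 - \<delta>) / (real ?n + 2)) \<le> norm p0 + 2"
      by (subst (asm) power_mono_iff) (simp_all add: \<Lambda>_def)
    then show ?thesis by (simp add: d_def)
  qed
  moreover have "\<Lambda> > 0" using c by (simp add: \<Lambda>_def)
  ultimately show ?thesis
    by (intro exI[of _ \<Lambda>] conjI allI impI; (elim conjE)?) (assumption | simp)+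
qed

end
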